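(* There is a deterministic distributed algorithm in the broadcast congested clique model that computes a maximal independent set of the input graph $G$ within $O(\log \Delta \log n)$ rounds, where $n$ is the number of nodes and $\Delta$ the maximum degree of $G$.
   Context: The input is an undirected graph $G=(V,E)$ with $n=|V|$ nodes, each node knowing its own unique $O(\log n)$-bit identifier and its incident edges. In the broadcast congested clique model, computation proceeds in synchronous rounds; in each round every node sends one and the same $O(\log n)$-bit message to all other $n-1$ nodes (communication is all-to-all, independent of $G$), and local computation is free. A maximal independent set is a set $I\subseteq V$ with no two nodes of $I$ adjacent in $G$ such that every node of $V\setminus I$ has a neighbor in $I$; at the end every node must know whether it belongs to $I$. *)

theory Defs
  imports Complex_Main
begin

definition simple_graph :: "nat \<Rightarrow> (nat \<Rightarrow> nat \<Rightarrow> bool) \<Rightarrow> bool" where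
  "simple_graph n E \<longleftrightarrow>
     (\<forall>u v. E u v \<longrightarrow> u < n \<and> v < n) \<and> (\<forall>u v. E u v \<longrightarrow> E v u) \<and> (\<forall>v. \<not> E v v)"

definition degree :: "nat \<Rightarrow> (nat \<Rightarrow> nat \<Rightarrow> bool) \<Rightarrow> nat \<Rightarrow> nat" where
  "degree n E v = card {u. u < n \<and> E v u}"

definition max_degree :: "nat \<Rightarrow> (nat \<Rightarrow> nat \<Rightarrow> bool) \<Rightarrow> nat" where
  "max_degree n E = Max ({degree n E v | v. v < n} \<union> {0})"

definition independent_set :: "nat \<Rightarrow> (nat \<Rightarrow> nat \<Rightarrow> bool) \<Rightarrow> nat set \<Rightarrow> bool" where
  "independent_set n E I \<longleftrightarrow> I \<subseteq> {..<n} \<and> (\<forall>u\<in>I. \<forall>v\<in>I. \<not> E u v)"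

definition maximal_independent_set :: "nat \<Rightarrow> (nat \<Rightarrow> nat \<Rightarrow> bool) \<Rightarrow> nat set \<Rightarrow> bool" where
  "maximal_independent_set n E I \<longleftrightarrow>
     independent_set n E I \<and> (\<forall>v<n. v \<notin> I \<longrightarrow> (\<exists>u\<in>I. E v u))"

text \<open>The local state of a node is its complete view: the number of nodes n, its own
identifier, the identifiers of its neighbours, and the list of everything it has received
so far (round r entry maps each identifier of a node to the message that node broadcast
in round r; None for identifiers not in use). Since local computation is free and
deterministic, an algorithm is given by a message function and an output function on
views; the message must be a number below (n+2)^c, i.e. O(log n) bits.\<close>

type_synonym view = "nat \<times> nat \<times> nat set \<times> (nat \<Rightarrow> nat option) list"

primrec views :: "(view \<Rightarrow> nat) \<Rightarrow> nat \<Rightarrow> (nat \<Rightarrow> nat \<Rightarrow> bool) \<Rightarrow> (nat \<Rightarrow> nat)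
                  \<Rightarrow> nat \<Rightarrow> nat \<Rightarrow> view" where
  "views msg n E idf 0 = (\<lambda>v. (n, idf v, {idf u | u. u < n \<and> E v u}, []))"
| "views msg n E idf (Suc t) =
     (\<lambda>v. let V = views msg n E idf t;
              rcv = (\<lambda>i. if i \<in> idf ` {..<n}
                         then Some (msg (V (the_inv_into {..<n} idf i))) else None);
              (n', i', N', h) = V v
          in (n', i', N', h @ [rcv]))"

definition computes_MIS_within ::
  "(view \<Rightarrow> nat) \<Rightarrow> (view \<Rightarrow> bool option) \<Rightarrow> nat \<Rightarrow> nat
   \<Rightarrow> nat \<Rightarrow> (nat \<Rightarrow> nat \<Rightarrow> bool) \<Rightarrow> (nat \<Rightarrow> nat) \<Rightarrow> bool" where
  "computes_MIS_within msg out c T n E idf \<longleftrightarrow>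
     (\<forall>t<T. \<forall>v<n. msg (views msg n E idf t v) < (n + 2) ^ c) \<and>
     (\<forall>v<n. out (views msg n E idf T v) \<noteq> None \<and>
            (\<forall>t\<ge>T. out (views msg n E idf t v) = out (views msg n E idf T v))) \<and>
     maximal_independent_set n E {v. v < n \<and> out (views msg n E idf T v) = Some True}"

end

theory Submission
  imports Defs "HOL-Library.FuncSet" "HOL-Library.Log_Nat" "HOL-Library.Monad_Syntax"
    "HOL-Library.Nat_Bijection"
begin

text \<open>
  If \<open>2 ^ \<Delta> \<le> n + 2\<close>, all neighbour lists can be broadcast in \<open>\<Delta>\<close> rounds. Otherwise
  \<open>log n < \<Delta>\<close>, and we derandomise Luby's algorithm with a seed of \<open>O(log \<Delta>)\<close> bits: a node of
  residual degree \<open>d\<close> is marked with probability between \<open>1 / (64 d)\<close> and \<open>1 / (32 d)\<close> and joins the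
  independent set if no neighbour of at least its level is marked. The analysis of a phase only uses
  a lower bound for the marking probabilities and an upper bound for pairs. Since \<open>log n < \<Delta>\<close>, a
  greedy choice of hash functions provides such markings with only polynomially many seeds in \<open>\<Delta>\<close>.
  A quadratic estimator of the number of removed arcs is a sum of terms that are known to single
  nodes, so the seed can be fixed with one broadcast per bit. A phase takes \<open>O(log \<Delta>)\<close> rounds and
  removes a constant fraction of the arcs, hence \<open>O(log n)\<close> phases suffice.
\<close>

section \<open>Almost pairwise independent markings\<close>

lemma card_div_mod_eq_sum:
  fixes A B :: nat
  assumes "0 < B"
  shows "card {c. c < A * B \<and> P (c div B) (c mod B)} = (\<Sum>a<A. card {b. b < B \<and> P a b})"
proof -
  have "bij_betw (\<lambda>(a, b). a * B + b) (SIGMA a:{..<A}. {b. b < B \<and> P a b})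
          {c. c < A * B \<and> P (c div B) (c mod B)}"
    (is "bij_betw ?f ?S ?T")
  proof (rule bij_betwI[where g = "\<lambda>c. (c div B, c mod B)"])
    show "?f \<in> ?S \<rightarrow> ?T"
    proof (clarsimp simp: assms)
      fix a b assume "a < A" "b < B"
      then have "a * B + b < (a + 1) * B" by simp
      also have "\<dots> \<le> A * B" using \<open>a < A\<close> by (intro mult_le_mono1) simp
      finally show "a * B + b < A * B" .
    qed
  qed (use assms in \<open>auto simp: less_mult_imp_div_less\<close>)
  then have "card ?S = card ?T" by (rule bij_betw_same_card)
  then show ?thesis by simp
qed

lemma card_cong_class:
  fixes a k q :: nat
  assumes "0 < q"
  shows "card {c. c < k * q \<and> c mod q = a mod q} = k"
proof -
  have "card {c. c < k * q \<and> c mod q = a mod q} = (\<Sum>i<k. card {b. b < q \<and> b = a mod q})"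
    by (rule card_div_mod_eq_sum[OF assms, where P = "\<lambda>_ b. b = a mod q"])
  also have "{b. b < q \<and> b = a mod q} = {a mod q}" using assms by auto
  finally show ?thesis by simp
qed

lemma card_nested_cong_classes:
  fixes a b k p q :: nat
  assumes "q dvd p" "0 < p"
  shows "card {c. c < k * p \<and> c mod q = a mod q \<and> c mod p = b mod p}
    = (if b mod q = a mod q then k else 0)"
proof -
  have coarser: "c mod q = b mod q" if "c mod p = b mod p" for c
    using that mod_mod_cancel[OF \<open>q dvd p\<close>] by metis
  show ?thesis
  proof (cases "b mod q = a mod q")
    case True
    then have "c mod q = a mod q \<and> c mod p = b mod p \<longleftrightarrow> c mod p = b mod p" for c
      using coarser[of c] by metis
    then show ?thesis using True card_cong_class[OF \<open>0 < p\<close>] by simp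
  next
    case False
    then have "\<not> (c mod q = a mod q \<and> c mod p = b mod p)" for c
      using coarser[of c] by metis
    then show ?thesis using False by simp
  qed
qed

abbreviation words :: "nat \<Rightarrow> nat \<Rightarrow> (nat \<Rightarrow> nat) set" where
  "words S p \<equiv> PiE {..<S} (\<lambda>_. {..<p})"

lemma finite_words: "finite (words S p)"
  by (intro finite_PiE) auto

definition collisions :: "nat \<Rightarrow> nat \<Rightarrow> (nat \<Rightarrow> nat) \<Rightarrow> (nat \<Rightarrow> nat) \<Rightarrow> nat" where
  "collisions S q w w' = card {s. s < S \<and> w s mod q = w' s mod q}"

lemma collisions_commute: "collisions S q w w' = collisions S q w' w"
  by (simp add: collisions_def eq_commute)

lemma sum_words_exp_collisions:
  assumes "0 < q"
  shows "(\<Sum>w\<in>words S (k * q). 2 ^ collisions S q w w') = (k * q + k) ^ S"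
proof -
  define weight :: "nat \<Rightarrow> nat \<Rightarrow> nat"
    where "weight s c = (if c mod q = w' s mod q then 2 else 1)" for s c
  have "2 ^ collisions S q w w' = (\<Prod>s<S. weight s (w s))" for w
  proof -
    have "(\<Prod>s<S. weight s (w s)) = (\<Prod>s\<in>{s \<in> {..<S}. w s mod q = w' s mod q}. 2)"
      unfolding weight_def by (subst prod.inter_filter) auto
    then show ?thesis by (simp add: collisions_def)
  qed
  then have "(\<Sum>w\<in>words S (k * q). 2 ^ collisions S q w w')
      = (\<Sum>w\<in>words S (k * q). \<Prod>s<S. weight s (w s))"
    by simp
  also have "\<dots> = (\<Prod>s<S. \<Sum>c<k * q. weight s c)"
    by (rule prod_sum_PiE[symmetric]) auto
  also have "\<dots> = (\<Prod>s<S. k * q + k)"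
  proof (rule prod.cong[OF refl])
    fix s
    have "weight s c = 1 + of_bool (c mod q = w' s mod q)" for c by (simp add: weight_def)
    then have "(\<Sum>c<k * q. weight s c) = k * q + card {c. c < k * q \<and> c mod q = w' s mod q}"
      by (simp add: sum_Suc Int_def)
    then show "(\<Sum>c<k * q. weight s c) = k * q + k" by (simp add: card_cong_class assms)
  qed
  finally show ?thesis by simp
qed

lemma one_plus_inverse_power_le_4:
  fixes q :: nat
  assumes "0 < q"
  shows "(1 + 1 / real q) ^ q \<le> 4"
  using exp_ge_one_plus_x_over_n_power_n[of q 1] exp_le assms by simp

lemma card_words_many_collisions:
  assumes "0 < q"
  shows "card {w \<in> words (q * t) (k * q). 4 * t < collisions (q * t) q w w'} * 4 ^ t
    \<le> (k * q) ^ (q * t)"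
proof -
  let ?S = "q * t"
  let ?bad = "{w \<in> words ?S (k * q). 4 * t < collisions ?S q w w'}"
  have "card ?bad * 2 ^ (4 * t) = (\<Sum>w\<in>?bad. 2 ^ (4 * t))" by simp
  also have "\<dots> \<le> (\<Sum>w\<in>?bad. 2 ^ collisions ?S q w w')"
    by (intro sum_mono power_increasing) auto
  also have "\<dots> \<le> (\<Sum>w\<in>words ?S (k * q). 2 ^ collisions ?S q w w')"
    by (intro sum_mono2 finite_words) auto
  also have "\<dots> = (k * q + k) ^ ?S" by (rule sum_words_exp_collisions[OF assms])
  finally have "real (card ?bad * 2 ^ (4 * t)) \<le> real ((k * q + k) ^ ?S)" by (rule of_nat_mono)
  also have "\<dots> = (real (k * q) * (1 + 1 / real q)) ^ ?S"
    using assms by (simp add: distrib_left)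
  also have "\<dots> = real (k * q) ^ ?S * ((1 + 1 / real q) ^ q) ^ t"
    by (simp add: power_mult_distrib power_mult)
  also have "\<dots> \<le> real (k * q) ^ ?S * 4 ^ t"
    using one_plus_inverse_power_le_4[OF assms] by (intro mult_left_mono power_mono) auto
  finally have "real (card ?bad) * 2 ^ (4 * t) \<le> real (k * q) ^ ?S * 4 ^ t" by simp
  moreover have "(2::real) ^ (4 * t) = 4 ^ t * 4 ^ t"
    unfolding power_mult power_mult_distrib[symmetric] by simp
  ultimately have "(real (card ?bad) * 4 ^ t) * 4 ^ t \<le> real (k * q) ^ ?S * 4 ^ t"
    by (simp only: mult.assoc)
  then have "real (card ?bad * 4 ^ t) \<le> real ((k * q) ^ ?S)" by simp
  then show ?thesis by (simp only: of_nat_le_iff)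
qed

lemma card_words_many_collisions_power2:
  assumes "j \<le> m"
  shows "card {w \<in> words (2 ^ (m + r)) (2 ^ m).
      4 * 2 ^ (m + r - j) < collisions (2 ^ (m + r)) (2 ^ j) w w'} * 4 ^ (2 ^ r)
    \<le> card (words (2 ^ (m + r)) (2 ^ m))" (is "card ?bad * _ \<le> _")
proof -
  have "card ?bad * 4 ^ (2 ^ r) \<le> card ?bad * 4 ^ (2 ^ (m + r - j))"
    using assms by (intro mult_le_mono2 power_increasing) auto
  also have "\<dots> \<le> (2 ^ (m - j) * 2 ^ j) ^ (2 ^ j * 2 ^ (m + r - j))"
    using card_words_many_collisions[of "2 ^ j" "2 ^ (m + r - j)" "2 ^ (m - j)" w'] assms
    by (simp flip: power_add)
  also have "\<dots> = card (words (2 ^ (m + r)) (2 ^ m))"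
    using assms by (simp add: card_PiE flip: power_add)
  finally show ?thesis .
qed

text \<open>The greedy step of the Gilbert--Varshamov bound: the words that collide too often with one of
  the given words do not exhaust all words.\<close>

lemma exists_word_few_collisions:
  assumes "N * (m + 1) < 4 ^ (2 ^ r)"
  shows "\<exists>w. \<forall>x<N. \<forall>j\<le>m. collisions (2 ^ (m + r)) (2 ^ j) w (h x) \<le> 4 * 2 ^ (m + r - j)"
proof -
  let ?W = "words (2 ^ (m + r)) (2 ^ m)"
  define bad where "bad = (\<lambda>(x, j).
    {w \<in> ?W. 4 * 2 ^ (m + r - j) < collisions (2 ^ (m + r)) (2 ^ j) w (h x)})"
  let ?I = "{..<N} \<times> {..m}"
  have "card (\<Union>i\<in>?I. bad i) * 4 ^ (2 ^ r) \<le> (\<Sum>i\<in>?I. card (bad i)) * 4 ^ (2 ^ r)"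
    by (intro mult_le_mono1 card_UN_le) simp
  also have "\<dots> \<le> (\<Sum>i\<in>?I. card ?W)"
    unfolding sum_distrib_right
    by (intro sum_mono) (auto simp: bad_def intro: card_words_many_collisions_power2)
  also have "\<dots> = N * (m + 1) * card ?W" by simp
  also have "\<dots> < 4 ^ (2 ^ r) * card ?W"
    using assms by (intro mult_strict_right_mono) (auto simp: card_PiE)
  finally have "card (\<Union>i\<in>?I. bad i) < card ?W" by simp
  moreover have "finite (\<Union>i\<in>?I. bad i)" by (auto simp: bad_def finite_words)
  ultimately have "\<not> ?W \<subseteq> (\<Union>i\<in>?I. bad i)" by (metis card_mono not_less)
  then show ?thesis by (fastforce simp: bad_def not_less)
qed

lemma hash_family_exists:
  assumes "N * (m + 1) < 4 ^ (2 ^ r)"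
  shows "\<exists>h. \<forall>x<N. \<forall>y<N. x \<noteq> y \<longrightarrow>
    (\<forall>j\<le>m. collisions (2 ^ (m + r)) (2 ^ j) (h x) (h y) \<le> 4 * 2 ^ (m + r - j))"
  using assms
proof (induction N)
  case 0
  then show ?case by simp
next
  case (Suc N)
  then obtain h where h: "\<forall>x<N. \<forall>y<N. x \<noteq> y \<longrightarrow>
    (\<forall>j\<le>m. collisions (2 ^ (m + r)) (2 ^ j) (h x) (h y) \<le> 4 * 2 ^ (m + r - j))"
    by auto
  have "N * (m + 1) < 4 ^ (2 ^ r)" using Suc.prems by simp
  from exists_word_few_collisions[OF this] obtain w where
    w: "\<forall>x<N. \<forall>j\<le>m. collisions (2 ^ (m + r)) (2 ^ j) w (h x) \<le> 4 * 2 ^ (m + r - j)"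
    by blast
  show ?case
    by (rule exI[of _ "h(N := w)"])
      (use h w in \<open>auto simp: less_Suc_eq collisions_commute[of _ _ _ w]\<close>)
qed

text \<open>Under a uniformly random seed, a node is marked at level \<open>j\<close> with probability exactly
  \<open>2 ^ - j\<close>, and two nodes are marked independently up to a factor 4.\<close>

definition marking :: "nat \<Rightarrow> nat \<Rightarrow> nat \<Rightarrow> (nat \<Rightarrow> nat \<Rightarrow> nat \<Rightarrow> bool) \<Rightarrow> bool" where
  "marking N m L mark \<longleftrightarrow>
    (\<forall>x. \<forall>j\<le>m. real (card {s. s < 2 ^ L \<and> mark s x j}) = 2 ^ L / 2 ^ j) \<and>
    (\<forall>x<N. \<forall>y<N. x \<noteq> y \<longrightarrow> (\<forall>i\<le>m. \<forall>j\<le>m.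
       real (card {s. s < 2 ^ L \<and> mark s x i \<and> mark s y j}) \<le> 4 * 2 ^ L / (2 ^ i * 2 ^ j)))"

text \<open>A seed consists of a position of the words and a residue. Of two congruences modulo powers of
  two the finer one fixes the residue, and then the coarser one is a collision at that position.\<close>

definition hash_mark :: "nat \<Rightarrow> (nat \<Rightarrow> nat \<Rightarrow> nat) \<Rightarrow> nat \<Rightarrow> nat \<Rightarrow> nat \<Rightarrow> bool" where
  "hash_mark m h s x j \<longleftrightarrow> s mod 2 ^ m mod 2 ^ j = h x (s div 2 ^ m) mod 2 ^ j"

lemma card_hash_mark:
  assumes "j \<le> m"
  shows "card {s. s < S * 2 ^ m \<and> hash_mark m h s x j} = S * 2 ^ (m - j)"
proof -
  have "card {s. s < S * 2 ^ m \<and> hash_mark m h s x j}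
    = (\<Sum>a<S. card {c. c < 2 ^ m \<and> c mod 2 ^ j = h x a mod 2 ^ j})"
    unfolding hash_mark_def
    by (rule card_div_mod_eq_sum[where P = "\<lambda>a c. c mod 2 ^ j = h x a mod 2 ^ j"]) simp
  also have "\<dots> = (\<Sum>a<S. 2 ^ (m - j))"
    using card_cong_class[of "2 ^ j" "2 ^ (m - j)"] assms
    by (intro sum.cong) (simp_all flip: power_add)
  finally show ?thesis by simp
qed

lemma card_hash_mark_pair:
  assumes "i \<le> j" "j \<le> m"
  shows "card {s. s < S * 2 ^ m \<and> hash_mark m h s x i \<and> hash_mark m h s y j}
    = collisions S (2 ^ i) (h x) (h y) * 2 ^ (m - j)"
proof -
  have "card {s. s < S * 2 ^ m \<and> hash_mark m h s x i \<and> hash_mark m h s y j}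
    = (\<Sum>a<S. card {c. c < 2 ^ m \<and> c mod 2 ^ i = h x a mod 2 ^ i \<and> c mod 2 ^ j = h y a mod 2 ^ j})"
    unfolding hash_mark_def
    by (rule card_div_mod_eq_sum[where
          P = "\<lambda>a c. c mod 2 ^ i = h x a mod 2 ^ i \<and> c mod 2 ^ j = h y a mod 2 ^ j"]) simp
  also have "\<dots> = (\<Sum>a<S. if h y a mod 2 ^ i = h x a mod 2 ^ i then 2 ^ (m - j) else 0)"
    using card_nested_cong_classes[of "2 ^ i" "2 ^ j" "2 ^ (m - j)"] assms
    by (intro sum.cong) (simp_all add: le_imp_power_dvd flip: power_add)
  also have "\<dots> = collisions S (2 ^ i) (h y) (h x) * 2 ^ (m - j)"
    by (simp add: collisions_def flip: sum.inter_filter)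
  finally show ?thesis by (simp add: collisions_commute)
qed

lemma marking_exists:
  assumes "N * (m + 1) < 4 ^ (2 ^ r)"
  shows "\<exists>mark. marking N m (2 * m + r) mark"
proof -
  obtain h where few_collisions: "\<And>x y j. x < N \<Longrightarrow> y < N \<Longrightarrow> x \<noteq> y \<Longrightarrow> j \<le> m \<Longrightarrow>
      collisions (2 ^ (m + r)) (2 ^ j) (h x) (h y) \<le> 4 * 2 ^ (m + r - j)"
    using hash_family_exists[OF assms] by blast
  have seeds: "(2::nat) ^ (2 * m + r) = 2 ^ (m + r) * 2 ^ m" by (simp flip: power_add)
  have single:
    "real (card {s. s < 2 ^ (2 * m + r) \<and> hash_mark m h s x j}) = 2 ^ (2 * m + r) / 2 ^ j"
    if "j \<le> m" for x j
    unfolding seeds card_hash_mark[OF that] using that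
    by (simp add: eq_divide_eq flip: power_add)
  let ?pair = "\<lambda>x i y j.
    real (card {s. s < 2 ^ (2 * m + r) \<and> hash_mark m h s x i \<and> hash_mark m h s y j})"
  have ordered_pair: "?pair x i y j \<le> 4 * 2 ^ (2 * m + r) / (2 ^ i * 2 ^ j)"
    if "x < N" "y < N" "x \<noteq> y" "i \<le> j" "j \<le> m" for x y i j
  proof -
    have "?pair x i y j \<le> real (4 * 2 ^ (m + r - i) * 2 ^ (m - j))"
      unfolding seeds card_hash_mark_pair[OF \<open>i \<le> j\<close> \<open>j \<le> m\<close>]
      using few_collisions that by (intro of_nat_mono mult_le_mono1) auto
    also have "\<dots> = 4 * 2 ^ (2 * m + r) / (2 ^ i * 2 ^ j)"
      using that by (simp add: eq_divide_eq flip: power_add)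
    finally show ?thesis .
  qed
  have "?pair x i y j \<le> 4 * 2 ^ (2 * m + r) / (2 ^ i * 2 ^ j)"
    if "x < N" "y < N" "x \<noteq> y" "i \<le> m" "j \<le> m" for x y i j
    using ordered_pair[of x y i j] ordered_pair[of y x j i] that
    by (cases "i \<le> j") (auto simp: mult.commute conj_commute)
  then show ?thesis using single unfolding marking_def by blast
qed

section \<open>Independent sets in residual graphs\<close>

locale finite_graph =
  fixes X :: "'a set" and N :: "'a \<Rightarrow> 'a set"
  assumes finite_X: "finite X"
    and nbrs_subset: "N x \<subseteq> X"
    and nbrs_sym: "y \<in> N x \<Longrightarrow> x \<in> N y"
    and nbrs_irrefl: "x \<notin> N x"
begin

abbreviation deg :: "'a \<Rightarrow> nat" where
  "deg x \<equiv> card (N x)"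

lemma finite_nbrs: "finite (N x)"
  using nbrs_subset finite_X by (rule finite_subset)

lemma nbrs_outside: "x \<notin> X \<Longrightarrow> N x = {}"
  using nbrs_subset nbrs_sym by blast

lemma deg_pos: "y \<in> N x \<Longrightarrow> 0 < deg y"
  using nbrs_sym finite_nbrs by (auto simp: card_gt_0_iff)

lemma deg_le_card: "deg x \<le> card X"
  using nbrs_subset finite_X by (intro card_mono)

end

definition induced :: "('a \<Rightarrow> 'a set) \<Rightarrow> 'a set \<Rightarrow> 'a \<Rightarrow> 'a set" where
  "induced N U x = (if x \<in> U then N x \<inter> U else {})"

definition vol :: "'a set \<Rightarrow> ('a \<Rightarrow> 'a set) \<Rightarrow> nat" where
  "vol X N = (\<Sum>x\<in>X. card (N x))"

definition max_deg :: "'a set \<Rightarrow> ('a \<Rightarrow> 'a set) \<Rightarrow> nat" where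
  "max_deg X N = Max (insert 0 ((\<lambda>x. card (N x)) ` X))"

definition mis :: "'a set \<Rightarrow> ('a \<Rightarrow> 'a set) \<Rightarrow> 'a set \<Rightarrow> bool" where
  "mis X N I \<longleftrightarrow> I \<subseteq> X \<and> (\<forall>x\<in>I. N x \<inter> I = {}) \<and> (\<forall>x\<in>X - I. N x \<inter> I \<noteq> {})"

context finite_graph
begin

lemma finite_graph_induced:
  assumes "U \<subseteq> X"
  shows "finite_graph U (induced N U)"
proof
  show "finite U" using assms finite_X by (rule finite_subset)
  show "x \<in> induced N U y" if "y \<in> induced N U x" for x y
    using that nbrs_sym[of y x] by (auto simp: induced_def split: if_splits)
qed (auto simp: induced_def nbrs_irrefl)

lemma card_induced_le: "card (induced N U x) \<le> deg x"
  unfolding induced_def by (intro card_mono finite_nbrs) auto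

lemma deg_le_max_deg: "deg x \<le> max_deg X N"
  using finite_X nbrs_outside[of x] unfolding max_deg_def by (cases "x \<in> X") auto

lemma max_deg_le_card: "max_deg X N \<le> card X"
  unfolding max_deg_def using finite_X deg_le_card by (subst Max_le_iff) auto

lemma vol_le: "vol X N \<le> card X * card X"
proof -
  have "vol X N \<le> (\<Sum>x\<in>X. card X)" unfolding vol_def by (intro sum_mono deg_le_card)
  then show ?thesis by simp
qed

lemma vol_induced_le:
  assumes "D \<subseteq> X" "U \<subseteq> X - D"
  shows "vol U (induced N U) + (\<Sum>x\<in>D. deg x) \<le> vol X N"
proof -
  have "vol U (induced N U) \<le> (\<Sum>x\<in>U. deg x)"
    unfolding vol_def by (intro sum_mono card_induced_le)
  also have "\<dots> \<le> (\<Sum>x\<in>X - D. deg x)"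
    using assms finite_X by (intro sum_mono2) auto
  finally show ?thesis
    unfolding vol_def using sum.subset_diff[OF \<open>D \<subseteq> X\<close> finite_X, of deg] by simp
qed

lemma mis_if_vol_eq_0:
  assumes "vol X N = 0"
  shows "mis X N X"
  using assms finite_X by (simp add: vol_def mis_def finite_nbrs)

lemma mis_extend:
  assumes "J \<subseteq> X" "\<And>x. x \<in> J \<Longrightarrow> N x \<inter> J = {}"
    and "U = {x \<in> X. x \<notin> J \<and> N x \<inter> J = {}}" "mis U (induced N U) I"
  shows "mis X N (J \<union> I)"
proof -
  have "I \<subseteq> U" using assms(4) by (simp add: mis_def)
  then have "induced N U x \<inter> I = N x \<inter> I" if "x \<in> U" for x
    using that by (auto simp: induced_def)
  then have I: "x \<in> I \<Longrightarrow> N x \<inter> I = {}" "x \<in> U - I \<Longrightarrow> N x \<inter> I \<noteq> {}" for x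
    using assms(4) unfolding mis_def by blast+
  have "N x \<inter> I = {}" if "x \<in> J" for x
  proof -
    have "x \<notin> N y" if "y \<in> I" for y
      using \<open>I \<subseteq> U\<close> that \<open>x \<in> J\<close> by (auto simp: assms(3))
    then show ?thesis using nbrs_sym[of _ x] by auto
  qed
  moreover have "N x \<inter> J = {}" if "x \<in> I" for x
    using \<open>I \<subseteq> U\<close> that by (auto simp: assms(3))
  ultimately have "N x \<inter> (J \<union> I) = {}" if "x \<in> J \<union> I" for x
    using assms(2) I(1) that unfolding Int_Un_distrib by blast
  moreover have "N x \<inter> (J \<union> I) \<noteq> {}" if "x \<in> X - (J \<union> I)" for x
    using I(2)[of x] that by (auto simp: assms(3))
  moreover have "J \<union> I \<subseteq> X" using assms(1) \<open>I \<subseteq> U\<close> by (auto simp: assms(3))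
  ultimately show ?thesis by (simp add: mis_def)
qed

lemma mis_exists: "\<exists>I. mis X N I"
proof -
  let ?independent = "{I. I \<subseteq> X \<and> (\<forall>x\<in>I. N x \<inter> I = {})}"
  have "finite ?independent" by (rule finite_subset[of _ "Pow X"]) (auto simp: finite_X)
  moreover have "?independent \<noteq> {}" by auto
  ultimately obtain I where I: "I \<in> ?independent" "\<forall>J\<in>?independent. I \<subseteq> J \<longrightarrow> I = J"
    by (rule finite_has_maximal[THEN bexE])
  have "N x \<inter> I \<noteq> {}" if "x \<in> X - I" for x
  proof
    assume "N x \<inter> I = {}"
    moreover from this have "x \<notin> N y" if "y \<in> I" for y
      using that nbrs_sym[of x y] by auto
    ultimately have "insert x I \<in> ?independent"
      using I(1) \<open>x \<in> X - I\<close> nbrs_irrefl[of x] by auto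
    then show False using bspec[OF I(2)] that by blast
  qed
  then show ?thesis using I(1) by (auto simp: mis_def)
qed

end

section \<open>Expected progress of a phase\<close>

definition level :: "nat \<Rightarrow> nat" where
  "level d = ceillog2 (32 * d)"

definition mark_prob :: "nat \<Rightarrow> real" where
  "mark_prob d = 1 / 2 ^ level d"

lemma level_mono: "d \<le> d' \<Longrightarrow> level d \<le> level d'"
  by (simp add: level_def ceillog2_mono)

lemma two_power_level_less: "0 < d \<Longrightarrow> 2 ^ level d < 64 * d"
  unfolding level_def using two_power_ceillog2_gt[of "32 * d"] by simp

lemma mark_prob_pos: "0 < mark_prob d"
  by (simp add: mark_prob_def)

lemma mark_prob_antimono: "level d \<le> level d' \<Longrightarrow> mark_prob d' \<le> mark_prob d"
  by (simp add: mark_prob_def divide_simps)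

lemma mult_mark_prob_le: "real d * mark_prob d \<le> 1 / 32"
proof -
  have "real (32 * d) \<le> real (2 ^ level d)"
    unfolding level_def by (rule of_nat_mono[OF le_two_power_ceillog2])
  then show ?thesis by (simp add: mark_prob_def field_simps)
qed

lemma mult_mark_prob_ge:
  assumes "0 < d"
  shows "1 / 64 \<le> real d * mark_prob d"
proof -
  have "real (2 ^ level d) \<le> real (64 * d)"
    using two_power_level_less[OF assms] by (intro of_nat_mono) simp
  then show ?thesis by (simp add: mark_prob_def field_simps)
qed

lemma mark_prob_le:
  assumes "0 < d"
  shows "mark_prob d \<le> 1 / 32"
proof -
  have "1 * mark_prob d \<le> real d * mark_prob d"
    using assms mark_prob_pos[of d] by (intro mult_right_mono) auto
  then show ?thesis using mult_mark_prob_le[of d] by simp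
qed

definition lower :: "('a \<Rightarrow> nat) \<Rightarrow> 'a \<Rightarrow> 'a set \<Rightarrow> 'a set" where
  "lower d x A = {v \<in> A. level (d v) \<le> level (d x)}"

definition upper :: "('a \<Rightarrow> nat) \<Rightarrow> 'a \<Rightarrow> 'a set \<Rightarrow> 'a set" where
  "upper d x A = {v \<in> A. level (d x) \<le> level (d v)}"

definition winner :: "('a \<Rightarrow> nat) \<Rightarrow> 'a set \<Rightarrow> 'a \<Rightarrow> 'a set \<Rightarrow> bool" where
  "winner d M x A \<longleftrightarrow> x \<in> M \<and> upper d x A \<inter> M = {}"

text \<open>Bonferroni lower bound for the arcs removed at dominated nodes, when each node \<open>w\<close> counts only
  its marked lower neighbours in \<open>S w\<close>. The last term charges the blocking of \<open>x\<close> to \<open>x\<close> itself and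
  not to the neighbours that lose their dominator, because a node sees its own neighbourhood only.\<close>

definition gain :: "('a \<Rightarrow> nat) \<Rightarrow> ('a \<Rightarrow> 'a set) \<Rightarrow> 'a set \<Rightarrow> 'a \<Rightarrow> 'a set \<Rightarrow> int" where
  "gain d S M x A =
     (let y = int (card (lower d x A \<inter> S x \<inter> M)) in int (d x) * (y - y * (y - 1)))
     - (if x \<in> M then int (card (upper d x A \<inter> M)) * (\<Sum>w | w \<in> upper d x A \<and> x \<in> S w. int (d w))
        else 0)"

lemma abs_gain_le:
  assumes "finite A" "card A \<le> c" "d x \<le> c" "\<And>w. w \<in> A \<Longrightarrow> d w \<le> c"
  shows "\<bar>gain d S M x A\<bar> \<le> 2 * int c ^ 3"
proof -
  define y where "y = int (card (lower d x A \<inter> S x \<inter> M))"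
  define h where "h = int (card (upper d x A \<inter> M))"
  define D where "D = (\<Sum>w | w \<in> upper d x A \<and> x \<in> S w. int (d w))"
  have card_le: "int (card B) \<le> int c" if "B \<subseteq> A" for B
    using card_mono[OF assms(1) that] assms(2) by simp
  have y: "0 \<le> y" "y \<le> int c" unfolding y_def by (simp, rule card_le) (auto simp: lower_def)
  have h: "0 \<le> h" "h \<le> int c" unfolding h_def by (simp, rule card_le) (auto simp: upper_def)
  have "D \<le> (\<Sum>w | w \<in> upper d x A \<and> x \<in> S w. int c)"
    unfolding D_def using assms(4) by (intro sum_mono) (auto simp: upper_def)
  also have "\<dots> \<le> int c * int c"
    using card_le[of "{w. w \<in> upper d x A \<and> x \<in> S w}"]
    by (auto simp: upper_def intro: mult_right_mono)
  finally have D: "0 \<le> D" "D \<le> int c * int c" by (auto simp: D_def intro: sum_nonneg)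
  have "y \<le> y * y" using y(1) by (cases "y = 0") auto
  then have "\<bar>y - y * (y - 1)\<bar> \<le> y * y" using y(1) by (simp add: algebra_simps abs_le_iff)
  also have "\<dots> \<le> int c * int c" using y by (intro mult_mono) auto
  finally have "\<bar>int (d x) * (y - y * (y - 1))\<bar> \<le> int c * (int c * int c)"
    unfolding abs_mult using assms(3) by (intro mult_mono) auto
  moreover have "\<bar>if x \<in> M then h * D else 0\<bar> \<le> int c * (int c * int c)"
    using h D by (simp add: abs_mult mult_mono)
  moreover have "gain d S M x A = int (d x) * (y - y * (y - 1)) - (if x \<in> M then h * D else 0)"
    by (simp add: gain_def y_def h_def D_def Let_def)
  ultimately show ?thesis unfolding power3_eq_cube by linarith
qed

context finite_graph
begin

abbreviation lowers :: "'a \<Rightarrow> 'a set" where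
  "lowers w \<equiv> lower deg w (N w)"

abbreviation uppers :: "'a \<Rightarrow> 'a set" where
  "uppers v \<equiv> upper deg v (N v)"

abbreviation winners :: "'a set \<Rightarrow> 'a set" where
  "winners M \<equiv> {v. winner deg M v (N v)}"

lemma lowers_subset: "lowers w \<subseteq> X" and uppers_subset: "uppers v \<subseteq> X"
  using nbrs_subset by (auto simp: lower_def upper_def)

lemma finite_lowers: "finite (lowers w)" and finite_uppers: "finite (uppers v)"
  by (rule finite_subset[OF lowers_subset finite_X], rule finite_subset[OF uppers_subset finite_X])

lemma card_lowers_le: "card (lowers w) \<le> deg w" and card_uppers_le: "card (uppers v) \<le> deg v"
  by (auto intro!: card_mono simp: finite_nbrs lower_def upper_def)

lemma mem_lowers_iff_mem_uppers: "v \<in> lowers w \<longleftrightarrow> w \<in> uppers v"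
  using nbrs_sym by (auto simp: lower_def upper_def)

lemma winners_independent:
  assumes "x \<in> winners M"
  shows "N x \<inter> winners M = {}"
proof (rule ccontr)
  assume "N x \<inter> winners M \<noteq> {}"
  then obtain y where "y \<in> N x" "y \<in> winners M" by blast
  moreover from this have "x \<in> N y" using nbrs_sym by blast
  ultimately show False
    using assms by (cases "level (deg x) \<le> level (deg y)") (auto simp: winner_def upper_def)
qed

lemma sum_mark_prob_uppers_le: "(\<Sum>u\<in>uppers v. mark_prob (deg u)) \<le> 1 / 32"
proof -
  have "(\<Sum>u\<in>uppers v. mark_prob (deg u)) \<le> (\<Sum>u\<in>uppers v. mark_prob (deg v))"
    by (intro sum_mono mark_prob_antimono) (auto simp: upper_def)
  also have "\<dots> \<le> real (deg v) * mark_prob (deg v)"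
    using card_uppers_le[of v] mark_prob_pos[of "deg v"] by (simp add: mult_right_mono)
  also have "\<dots> \<le> 1 / 32" by (rule mult_mark_prob_le)
  finally show ?thesis .
qed

lemma vol_le_twice_lowers: "vol X N \<le> 2 * (\<Sum>w\<in>X. card (lowers w))"
proof -
  have "(\<Sum>w\<in>X. card (lowers w)) = (\<Sum>w\<in>X. \<Sum>v\<in>X. of_bool (v \<in> lowers w))"
    using finite_X lowers_subset by (simp add: Int_absorb1)
  also have "\<dots> = (\<Sum>v\<in>X. \<Sum>w\<in>X. of_bool (w \<in> uppers v))"
    unfolding mem_lowers_iff_mem_uppers by (rule sum.swap)
  also have "\<dots> = (\<Sum>v\<in>X. card (uppers v))"
    using finite_X uppers_subset by (simp add: Int_absorb1)
  finally have lowers_eq_uppers: "(\<Sum>w\<in>X. card (lowers w)) = (\<Sum>v\<in>X. card (uppers v))" .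
  have "deg w \<le> card (lowers w) + card (uppers w)" for w
  proof -
    have "N w = lowers w \<union> uppers w" by (auto simp: lower_def upper_def)
    then show ?thesis using card_Un_le[of "lowers w" "uppers w"] by simp
  qed
  then have "vol X N \<le> (\<Sum>w\<in>X. card (lowers w) + card (uppers w))"
    unfolding vol_def by (intro sum_mono)
  then show ?thesis by (simp add: sum.distrib lowers_eq_uppers)
qed

text \<open>The part of the total gain that concerns the domination of \<open>w\<close>.\<close>

definition credit :: "('a \<Rightarrow> 'a set) \<Rightarrow> 'a set \<Rightarrow> 'a \<Rightarrow> int" where
  "credit S M w = (let K = lowers w \<inter> S w \<inter> M; y = int (card K) in
     y - y * (y - 1) - (\<Sum>v\<in>K. int (card (uppers v \<inter> M))))"

lemma sum_gain_eq_sum_credit: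
  "(\<Sum>x\<in>X. gain deg S M x (N x)) = (\<Sum>w\<in>X. int (deg w) * credit S M w)"
proof -
  let ?K = "\<lambda>w. lowers w \<inter> S w \<inter> M"
  let ?h = "\<lambda>v. int (card (uppers v \<inter> M))"
  have "(\<Sum>v\<in>X. if v \<in> M then ?h v * (\<Sum>w | w \<in> uppers v \<and> v \<in> S w. int (deg w)) else 0)
      = (\<Sum>v\<in>X. \<Sum>w | w \<in> X \<and> v \<in> ?K w. int (deg w) * ?h v)"
  proof (rule sum.cong[OF refl])
    fix v
    have "{w. w \<in> X \<and> v \<in> ?K w} = (if v \<in> M then {w. w \<in> uppers v \<and> v \<in> S w} else {})"
      using uppers_subset by (auto simp: mem_lowers_iff_mem_uppers)
    then show "(if v \<in> M then ?h v * (\<Sum>w | w \<in> uppers v \<and> v \<in> S w. int (deg w)) else 0)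
        = (\<Sum>w | w \<in> X \<and> v \<in> ?K w. int (deg w) * ?h v)"
      by (simp add: sum_distrib_left mult.commute)
  qed
  also have "\<dots> = (\<Sum>w\<in>X. \<Sum>v | v \<in> X \<and> v \<in> ?K w. int (deg w) * ?h v)"
    by (rule sum.swap_restrict[OF finite_X finite_X])
  also have "\<dots> = (\<Sum>w\<in>X. int (deg w) * (\<Sum>v\<in>?K w. ?h v))"
  proof (rule sum.cong[OF refl])
    fix w
    have "{v. v \<in> X \<and> v \<in> ?K w} = ?K w" using lowers_subset by auto
    then show "(\<Sum>v | v \<in> X \<and> v \<in> ?K w. int (deg w) * ?h v) = int (deg w) * (\<Sum>v\<in>?K w. ?h v)"
      by (simp only: sum_distrib_left)
  qed
  finally show ?thesis
    by (simp add: gain_def credit_def Let_def sum_subtractf right_diff_distrib)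
qed

lemma credit_le: "credit S M w \<le> of_bool (N w \<inter> winners M \<noteq> {})"
proof -
  let ?K = "lowers w \<inter> S w \<inter> M"
  let ?y = "int (card ?K)" and ?blocked = "\<Sum>v\<in>?K. int (card (uppers v \<inter> M))"
  show ?thesis
  proof (cases "N w \<inter> winners M = {}")
    case True
    have "1 \<le> int (card (uppers v \<inter> M))" if "v \<in> ?K" for v
    proof -
      have "uppers v \<inter> M \<noteq> {}" using that True by (auto simp: winner_def lower_def)
      then show ?thesis using finite_uppers by (simp add: card_gt_0_iff Suc_le_eq)
    qed
    then have "(\<Sum>v\<in>?K. 1) \<le> ?blocked" by (rule sum_mono)
    then have "?y \<le> ?blocked" by simp
    moreover have "0 \<le> ?y * (?y - 1)" by (cases "card ?K") auto
    ultimately show ?thesis by (simp add: credit_def Let_def True)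
  next
    case False
    have "0 \<le> (?y - 1) * (?y - 1)" by simp
    then have "?y - ?y * (?y - 1) \<le> 1" by (simp add: algebra_simps)
    moreover have "0 \<le> ?blocked" by (intro sum_nonneg) auto
    ultimately show ?thesis using False by (simp add: credit_def Let_def)
  qed
qed

lemma real_credit_eq:
  "real_of_int (credit S M w) = real (card (lowers w \<inter> S w \<inter> M))
    - (\<Sum>v\<in>lowers w \<inter> S w \<inter> M. real (card ((lowers w \<inter> S w - {v}) \<inter> M)))
    - (\<Sum>v\<in>lowers w \<inter> S w \<inter> M. real (card (uppers v \<inter> M)))"
proof -
  let ?K = "lowers w \<inter> S w"
  have "real (card ((?K - {v}) \<inter> M)) = real (card (?K \<inter> M)) - 1" if "v \<in> ?K \<inter> M" for v
  proof -
    have "(?K - {v}) \<inter> M = ?K \<inter> M - {v}" by auto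
    moreover have "finite (?K \<inter> M)" using finite_lowers by blast
    ultimately show ?thesis using that card.remove[of "?K \<inter> M" v] by simp
  qed
  then show ?thesis by (simp add: credit_def Let_def)
qed

lemma sum_gain_le:
  "(\<Sum>x\<in>X. gain deg S M x (N x)) \<le> (\<Sum>w | w \<in> X \<and> N w \<inter> winners M \<noteq> {}. int (deg w))"
proof -
  have "(\<Sum>x\<in>X. gain deg S M x (N x)) \<le> (\<Sum>w\<in>X. int (deg w) * of_bool (N w \<inter> winners M \<noteq> {}))"
    unfolding sum_gain_eq_sum_credit by (intro sum_mono mult_left_mono credit_le) auto
  also have "\<dots> = (\<Sum>w\<in>X. if N w \<inter> winners M \<noteq> {} then int (deg w) else 0)"
    by (intro sum.cong) auto
  also have "\<dots> = (\<Sum>w | w \<in> X \<and> N w \<inter> winners M \<noteq> {}. int (deg w))"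
    by (rule sum.inter_filter[symmetric, OF finite_X])
  finally show ?thesis .
qed

end

text \<open>A uniformly random seed from \<open>\<Omega>\<close> marks the set \<open>M s\<close>.\<close>

locale marked_graph = finite_graph X N for X :: "'a set" and N :: "'a \<Rightarrow> 'a set" +
  fixes S :: "'a \<Rightarrow> 'a set" and \<Omega> :: "'s set" and M :: "'s \<Rightarrow> 'a set"
  assumes finite_\<Omega>: "finite \<Omega>"
    and card_marked_ge: "v \<in> X \<Longrightarrow>
      real (card \<Omega>) * mark_prob (deg v) \<le> real (card {s \<in> \<Omega>. v \<in> M s})"
    and card_marked_pair_le: "u \<in> X \<Longrightarrow> v \<in> X \<Longrightarrow> u \<noteq> v \<Longrightarrow>
      real (card {s \<in> \<Omega>. u \<in> M s \<and> v \<in> M s})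
        \<le> 4 * real (card \<Omega>) * (mark_prob (deg u) * mark_prob (deg v))"
    and sum_kept_ge: "w \<in> X \<Longrightarrow>
      real (card (lowers w)) * mark_prob (deg w) \<le> (\<Sum>v\<in>lowers w \<inter> S w. mark_prob (deg v))"
    and sum_kept_le: "w \<in> X \<Longrightarrow> (\<Sum>v\<in>lowers w \<inter> S w. mark_prob (deg v)) \<le> 1 / 16"
begin

lemma sum_card_marked_ge:
  assumes "A \<subseteq> X"
  shows "real (card \<Omega>) * (\<Sum>v\<in>A. mark_prob (deg v)) \<le> (\<Sum>s\<in>\<Omega>. real (card (A \<inter> M s)))"
proof -
  have "finite A" using assms finite_X by (rule finite_subset)
  have "real (card \<Omega>) * (\<Sum>v\<in>A. mark_prob (deg v)) \<le> (\<Sum>v\<in>A. real (card {s \<in> \<Omega>. v \<in> M s}))"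
    unfolding sum_distrib_left using assms by (intro sum_mono card_marked_ge) auto
  also have "\<dots> = (\<Sum>v\<in>A. \<Sum>s\<in>\<Omega>. of_bool (v \<in> M s))"
    using finite_\<Omega> by (simp add: Int_def)
  also have "\<dots> = (\<Sum>s\<in>\<Omega>. \<Sum>v\<in>A. of_bool (v \<in> M s))" by (rule sum.swap)
  also have "\<dots> = (\<Sum>s\<in>\<Omega>. real (card (A \<inter> M s)))"
    using \<open>finite A\<close> by simp
  finally show ?thesis .
qed

lemma sum_card_marked_pairs_le:
  assumes "A \<subseteq> X" "\<And>v. v \<in> A \<Longrightarrow> R v \<subseteq> X - {v}"
    and "\<And>v. v \<in> A \<Longrightarrow> (\<Sum>u\<in>R v. mark_prob (deg u)) \<le> \<beta>"
  shows "(\<Sum>s\<in>\<Omega>. \<Sum>v\<in>A \<inter> M s. real (card (R v \<inter> M s)))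
    \<le> 4 * \<beta> * real (card \<Omega>) * (\<Sum>v\<in>A. mark_prob (deg v))"
proof -
  have "finite A" using assms(1) finite_X by (rule finite_subset)
  have finite_R: "finite (R v)" if "v \<in> A" for v
    using assms(2)[OF that] finite_X by (rule finite_subset[OF _ finite_Diff])
  have "(\<Sum>v\<in>A \<inter> M s. real (card (R v \<inter> M s)))
      = (\<Sum>v\<in>A. \<Sum>u\<in>R v. of_bool (u \<in> M s \<and> v \<in> M s))" for s
    unfolding sum.inter_restrict[OF \<open>finite A\<close>]
    by (intro sum.cong) (auto simp: finite_R Int_def)
  then have "(\<Sum>s\<in>\<Omega>. \<Sum>v\<in>A \<inter> M s. real (card (R v \<inter> M s)))
      = (\<Sum>v\<in>A. \<Sum>u\<in>R v. \<Sum>s\<in>\<Omega>. of_bool (u \<in> M s \<and> v \<in> M s))"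
    by (simp only: sum.swap[of _ _ \<Omega>])
  also have "\<dots> = (\<Sum>v\<in>A. \<Sum>u\<in>R v. real (card {s \<in> \<Omega>. u \<in> M s \<and> v \<in> M s}))"
    using finite_\<Omega> by (simp add: Int_def)
  also have "\<dots> \<le> (\<Sum>v\<in>A. \<Sum>u\<in>R v. 4 * real (card \<Omega>) * (mark_prob (deg u) * mark_prob (deg v)))"
    using assms(1,2) by (intro sum_mono card_marked_pair_le) auto
  also have "\<dots> = (\<Sum>v\<in>A. 4 * real (card \<Omega>) * mark_prob (deg v) * (\<Sum>u\<in>R v. mark_prob (deg u)))"
    by (simp add: sum_distrib_left mult_ac)
  also have "\<dots> \<le> (\<Sum>v\<in>A. 4 * real (card \<Omega>) * mark_prob (deg v) * \<beta>)"
    using assms(3) by (intro sum_mono mult_left_mono) (auto simp: mark_prob_def)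
  also have "\<dots> = 4 * \<beta> * real (card \<Omega>) * (\<Sum>v\<in>A. mark_prob (deg v))"
    by (simp add: sum_distrib_left mult_ac)
  finally show ?thesis .
qed

lemma sum_credit_ge:
  assumes "w \<in> X"
  shows "real (card \<Omega>) / 2 * (\<Sum>v\<in>lowers w \<inter> S w. mark_prob (deg v))
    \<le> real_of_int (\<Sum>s\<in>\<Omega>. credit S (M s) w)"
proof -
  let ?K = "lowers w \<inter> S w"
  let ?P = "real (card \<Omega>) * (\<Sum>v\<in>?K. mark_prob (deg v))"
  have K: "?K \<subseteq> X" using lowers_subset by auto
  have "real_of_int (\<Sum>s\<in>\<Omega>. credit S (M s) w) = (\<Sum>s\<in>\<Omega>. real (card (?K \<inter> M s)))
      - (\<Sum>s\<in>\<Omega>. \<Sum>v\<in>?K \<inter> M s. real (card ((?K - {v}) \<inter> M s)))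
      - (\<Sum>s\<in>\<Omega>. \<Sum>v\<in>?K \<inter> M s. real (card (uppers v \<inter> M s)))"
    by (simp add: real_credit_eq sum_subtractf)
  moreover have "?P \<le> (\<Sum>s\<in>\<Omega>. real (card (?K \<inter> M s)))"
    by (rule sum_card_marked_ge[OF K])
  moreover have "(\<Sum>s\<in>\<Omega>. \<Sum>v\<in>?K \<inter> M s. real (card ((?K - {v}) \<inter> M s))) \<le> 4 * (1 / 16) * ?P"
  proof -
    have "(\<Sum>u\<in>?K - {v}. mark_prob (deg u)) \<le> 1 / 16" for v
      using sum_mono2[of ?K "?K - {v}" "\<lambda>u. mark_prob (deg u)"] sum_kept_le[OF assms]
        finite_lowers mark_prob_pos
      by (fastforce intro: less_imp_le)
    then show ?thesis
      using sum_card_marked_pairs_le[OF K, of "\<lambda>v. ?K - {v}" "1 / 16"] K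
      by (auto simp: mult.assoc)
  qed
  moreover have "(\<Sum>s\<in>\<Omega>. \<Sum>v\<in>?K \<inter> M s. real (card (uppers v \<inter> M s))) \<le> 4 * (1 / 32) * ?P"
  proof -
    have "uppers v \<subseteq> X - {v}" for v
      using uppers_subset nbrs_irrefl by (auto simp: upper_def)
    then show ?thesis
      using sum_card_marked_pairs_le[OF K, of uppers "1 / 32"] sum_mark_prob_uppers_le
      by (simp add: mult.assoc)
  qed
  moreover have "0 \<le> ?P" by (intro mult_nonneg_nonneg sum_nonneg) (auto simp: mark_prob_def)
  ultimately show ?thesis by linarith
qed

lemma sum_deg_credit_ge:
  assumes "w \<in> X"
  shows "real (card \<Omega>) * real (card (lowers w))
    \<le> 128 * (real (deg w) * real_of_int (\<Sum>s\<in>\<Omega>. credit S (M s) w))"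
proof (cases "deg w = 0")
  case True
  then show ?thesis using card_lowers_le[of w] by simp
next
  case False
  have "real (card \<Omega>) * real (card (lowers w)) * (1 / 64)
      \<le> real (card \<Omega>) * real (card (lowers w)) * (real (deg w) * mark_prob (deg w))"
    using False by (intro mult_left_mono mult_mark_prob_ge) auto
  also have "\<dots> = real (deg w) * real (card \<Omega>) * (real (card (lowers w)) * mark_prob (deg w))"
    by (simp add: mult_ac)
  also have "\<dots> \<le> real (deg w) * real (card \<Omega>) * (\<Sum>v\<in>lowers w \<inter> S w. mark_prob (deg v))"
    by (intro mult_left_mono sum_kept_ge[OF assms]) auto
  also have "\<dots> = 2 * (real (deg w) *
      (real (card \<Omega>) / 2 * (\<Sum>v\<in>lowers w \<inter> S w. mark_prob (deg v))))"
    by simp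
  also have "\<dots> \<le> 2 * (real (deg w) * real_of_int (\<Sum>s\<in>\<Omega>. credit S (M s) w))"
    by (intro mult_left_mono sum_credit_ge[OF assms]) auto
  finally show ?thesis by simp
qed

lemma vol_le_sum_gain:
  "int (card \<Omega> * vol X N) \<le> 256 * (\<Sum>s\<in>\<Omega>. \<Sum>x\<in>X. gain deg S (M s) x (N x))"
proof -
  have "real (card \<Omega> * vol X N) \<le> real (card \<Omega> * (2 * (\<Sum>w\<in>X. card (lowers w))))"
    by (intro of_nat_mono mult_le_mono2 vol_le_twice_lowers)
  also have "\<dots> = 2 * (\<Sum>w\<in>X. real (card \<Omega>) * real (card (lowers w)))"
    by (simp add: sum_distrib_left mult_ac)
  also have "\<dots> \<le> 2 * (\<Sum>w\<in>X. 128 * (real (deg w) * real_of_int (\<Sum>s\<in>\<Omega>. credit S (M s) w)))"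
    by (intro mult_left_mono sum_mono sum_deg_credit_ge) auto
  also have "\<dots> = real_of_int (256 * (\<Sum>w\<in>X. \<Sum>s\<in>\<Omega>. int (deg w) * credit S (M s) w))"
    by (simp add: sum_distrib_left)
  also have "(\<Sum>w\<in>X. \<Sum>s\<in>\<Omega>. int (deg w) * credit S (M s) w)
      = (\<Sum>s\<in>\<Omega>. \<Sum>x\<in>X. gain deg S (M s) x (N x))"
    unfolding sum_gain_eq_sum_credit by (rule sum.swap)
  finally show ?thesis by linarith
qed

lemma vol_residual_le:
  assumes "\<Omega> \<noteq> {}"
    and above_average: "(\<Sum>s'\<in>\<Omega>. \<Sum>x\<in>X. gain deg S (M s') x (N x))
      \<le> int (card \<Omega>) * (\<Sum>x\<in>X. gain deg S (M s) x (N x))"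
    and "U \<subseteq> {x \<in> X. N x \<inter> winners (M s) = {}}"
  shows "256 * vol U (induced N U) \<le> 255 * vol X N"
proof -
  let ?D = "{w. w \<in> X \<and> N w \<inter> winners (M s) \<noteq> {}}"
  have "int (card \<Omega>) * int (vol X N)
      \<le> int (card \<Omega>) * (256 * (\<Sum>x\<in>X. gain deg S (M s) x (N x)))"
    using vol_le_sum_gain above_average by simp
  then have "int (vol X N) \<le> 256 * (\<Sum>x\<in>X. gain deg S (M s) x (N x))"
    using assms(1) finite_\<Omega> by (simp add: card_gt_0_iff)
  also have "\<dots> \<le> 256 * (\<Sum>w\<in>?D. int (deg w))" using sum_gain_le by simp
  finally have "int (vol X N) \<le> int (256 * (\<Sum>w\<in>?D. deg w))" by simp
  then have "vol X N \<le> 256 * (\<Sum>w\<in>?D. deg w)" by (simp only: of_nat_le_iff)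
  moreover have "vol U (induced N U) + (\<Sum>w\<in>?D. deg w) \<le> vol X N"
    by (rule vol_induced_le) (use assms(3) in auto)
  ultimately show ?thesis by linarith
qed

end

section \<open>Cutoffs\<close>

lemma Least_prefix_sum_bounds:
  fixes p :: "nat \<Rightarrow> real"
  assumes "finite A" "\<And>v. v \<in> A \<Longrightarrow> p v \<le> q" "0 \<le> q" "0 \<le> \<tau>" "\<tau> \<le> (\<Sum>v\<in>A. p v)"
  defines "t \<equiv> LEAST t. \<tau> \<le> (\<Sum>v\<in>A \<inter> {..<t}. p v)"
  shows "\<tau> \<le> (\<Sum>v\<in>A \<inter> {..<t}. p v)" "(\<Sum>v\<in>A \<inter> {..<t}. p v) \<le> \<tau> + q"
    and "A \<subseteq> {..<b} \<Longrightarrow> t \<le> b"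
proof -
  have whole: "\<tau> \<le> (\<Sum>v\<in>A \<inter> {..<b}. p v)" if "A \<subseteq> {..<b}" for b
    using that assms(5) by (simp add: Int_absorb2)
  obtain b where "A \<subseteq> {..<b}"
    using assms(1) finite_nat_set_iff_bounded by (metis lessThan_iff subsetI)
  then show "\<tau> \<le> (\<Sum>v\<in>A \<inter> {..<t}. p v)" unfolding t_def by (intro LeastI whole)
  show "t \<le> b" if "A \<subseteq> {..<b}" for b unfolding t_def by (intro Least_le whole that)
  show "(\<Sum>v\<in>A \<inter> {..<t}. p v) \<le> \<tau> + q"
  proof (cases t)
    case 0
    then show ?thesis using assms by simp
  next
    case (Suc i)
    then have "(\<Sum>v\<in>A \<inter> {..<i}. p v) < \<tau>"
      using not_less_Least[of i "\<lambda>t. \<tau> \<le> (\<Sum>v\<in>A \<inter> {..<t}. p v)"] by (simp add: t_def)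
    moreover have "(\<Sum>v\<in>A \<inter> {..<t}. p v) \<le> (\<Sum>v\<in>A \<inter> {..<i}. p v) + q"
      using assms(1-3) by (cases "i \<in> A") (auto simp: Suc lessThan_Suc Int_insert_right)
    ultimately show ?thesis by linarith
  qed
qed

text \<open>The total marking probability of the lower neighbours can be large. The cutoff keeps a prefix
  in identifier order, so that a single broadcast number tells every neighbour whether it was kept.\<close>

definition cutoff :: "(nat \<Rightarrow> nat) \<Rightarrow> nat \<Rightarrow> nat set \<Rightarrow> nat" where
  "cutoff d x A = (LEAST t. real (card (lower d x A)) * mark_prob (d x)
     \<le> (\<Sum>v\<in>lower d x A \<inter> {..<t}. mark_prob (d v)))"

lemma
  assumes "finite A" "card A \<le> d x" "\<And>v. v \<in> A \<Longrightarrow> 0 < d v"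
  shows sum_below_cutoff_ge: "real (card (lower d x A)) * mark_prob (d x)
      \<le> (\<Sum>v\<in>lower d x A \<inter> {..<cutoff d x A}. mark_prob (d v))" (is ?ge)
    and sum_below_cutoff_le: "(\<Sum>v\<in>lower d x A \<inter> {..<cutoff d x A}. mark_prob (d v)) \<le> 1 / 16"
      (is ?le)
    and cutoff_le: "A \<subseteq> {..<b} \<Longrightarrow> cutoff d x A \<le> b"
proof -
  let ?\<tau> = "real (card (lower d x A)) * mark_prob (d x)"
  have lower: "lower d x A \<subseteq> A" by (auto simp: lower_def)
  then have finite_lower: "finite (lower d x A)" using assms(1) by (rule finite_subset)
  have small: "mark_prob (d v) \<le> 1 / 32" if "v \<in> lower d x A" for v
    using that lower assms(3) by (blast intro: mark_prob_le)
  have "(\<Sum>v\<in>lower d x A. mark_prob (d x)) \<le> (\<Sum>v\<in>lower d x A. mark_prob (d v))"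
    by (intro sum_mono mark_prob_antimono) (simp add: lower_def)
  then have \<tau>_le_sum: "?\<tau> \<le> (\<Sum>v\<in>lower d x A. mark_prob (d v))" by simp
  have "card (lower d x A) \<le> d x" using card_mono[OF assms(1) lower] assms(2) by simp
  then have "?\<tau> \<le> real (d x) * mark_prob (d x)"
    using mark_prob_pos[of "d x"] by (intro mult_right_mono) auto
  then have \<tau>_le: "?\<tau> \<le> 1 / 32" using mult_mark_prob_le[of "d x"] by linarith
  have "0 \<le> ?\<tau>" using mark_prob_pos[of "d x"] by simp
  note prefix = Least_prefix_sum_bounds[OF finite_lower small _ this \<tau>_le_sum, folded cutoff_def]
  show ?ge using prefix(1) by simp
  show ?le using prefix(2) \<tau>_le by simp
  show "cutoff d x A \<le> b" if "A \<subseteq> {..<b}" using prefix(3) that lower by simp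
qed

section \<open>Broadcast programs\<close>

text \<open>Everything that is broadcast is public, so an algorithm is a tree that branches on what was
  heard; only the messages depend on the identifier and the neighbourhood of the sender.\<close>

datatype 'a prog = Ret 'a | Bcast "nat \<Rightarrow> nat set \<Rightarrow> nat" "(nat \<Rightarrow> nat option) \<Rightarrow> 'a prog"

primrec bind_prog :: "'a prog \<Rightarrow> ('a \<Rightarrow> 'b prog) \<Rightarrow> 'b prog" where
  "bind_prog (Ret a) f = f a"
| "bind_prog (Bcast \<mu> c) f = Bcast \<mu> (\<lambda>r. bind_prog (c r) f)"

adhoc_overloading Monad_Syntax.bind \<rightleftharpoons> bind_prog

definition heard :: "nat set \<Rightarrow> (nat \<Rightarrow> nat set) \<Rightarrow> (nat \<Rightarrow> nat set \<Rightarrow> nat) \<Rightarrow> nat \<Rightarrow> nat option" where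
  "heard X N \<mu> = (\<lambda>x. if x \<in> X then Some (\<mu> x (N x)) else None)"

primrec achieves ::
  "nat set \<Rightarrow> (nat \<Rightarrow> nat set) \<Rightarrow> nat \<Rightarrow> 'a prog \<Rightarrow> nat \<Rightarrow> ('a \<Rightarrow> bool) \<Rightarrow> bool" where
  "achieves X N B (Ret a) T Q \<longleftrightarrow> Q a"
| "achieves X N B (Bcast \<mu> c) T Q \<longleftrightarrow>
     0 < T \<and> (\<forall>x\<in>X. \<mu> x (N x) < B) \<and> achieves X N B (c (heard X N \<mu>)) (T - 1) Q"

lemma achieves_mono:
  assumes "achieves X N B p T Q" "T \<le> T'" "\<And>a. Q a \<Longrightarrow> Q' a"
  shows "achieves X N B p T' Q'"
  using assms(1,2)
proof (induction p arbitrary: T T')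
  case (Ret a)
  then show ?case using assms(3) by simp
next
  case (Bcast \<mu> c)
  then show ?case using Bcast.IH[OF rangeI, of "heard X N \<mu>" "T - 1" "T' - 1"] by simp
qed

lemma achieves_bind:
  assumes "achieves X N B p T R" "\<And>a. R a \<Longrightarrow> achieves X N B (f a) T' Q"
  shows "achieves X N B (p \<bind> f) (T + T') Q"
  using assms(1)
proof (induction p arbitrary: T)
  case (Ret a)
  then show ?case using assms(2) achieves_mono[of X N B "f a" T' Q "T + T'"] by simp
next
  case (Bcast \<mu> c)
  then show ?case using Bcast.IH[OF rangeI, of "heard X N \<mu>" "T - 1"] by simp
qed

primrec restrict_prog :: "nat set \<Rightarrow> 'a prog \<Rightarrow> 'a prog" where
  "restrict_prog U (Ret a) = Ret a"
| "restrict_prog U (Bcast \<mu> c) =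
     Bcast (\<lambda>x A. if x \<in> U then \<mu> x (A \<inter> U) else 0) (\<lambda>r. restrict_prog U (c (r |` U)))"

lemma achieves_restrict_prog:
  assumes "achieves U (induced N U) B p T Q" "U \<subseteq> X" "0 < B"
  shows "achieves X N B (restrict_prog U p) T Q"
  using assms(1)
proof (induction p arbitrary: T)
  case (Ret a)
  then show ?case by simp
next
  case (Bcast \<mu> c)
  have "heard X N (\<lambda>x A. if x \<in> U then \<mu> x (A \<inter> U) else 0) |` U = heard U (induced N U) \<mu>"
    using assms(2) by (intro ext) (auto simp: heard_def restrict_map_def induced_def)
  moreover have "\<forall>x\<in>X. (if x \<in> U then \<mu> x (N x \<inter> U) else 0) < B"
    using Bcast.prems assms(3) by (simp add: induced_def)
  ultimately show ?case using Bcast.IH[OF rangeI] Bcast.prems by simp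
qed

definition ask :: "(nat \<Rightarrow> nat set \<Rightarrow> nat) \<Rightarrow> (nat \<Rightarrow> nat) prog" where
  "ask \<mu> = Bcast \<mu> (\<lambda>r. Ret (\<lambda>x. case r x of None \<Rightarrow> 0 | Some y \<Rightarrow> y))"

lemma achieves_ask:
  assumes "\<And>x. x \<in> X \<Longrightarrow> \<mu> x (N x) < B"
    and "achieves X N B (f (\<lambda>x. if x \<in> X then \<mu> x (N x) else 0)) T Q"
  shows "achieves X N B (ask \<mu> \<bind> f) (Suc T) Q"
proof -
  have "(\<lambda>x. case heard X N \<mu> x of None \<Rightarrow> 0 | Some y \<Rightarrow> y) = (\<lambda>x. if x \<in> X then \<mu> x (N x) else 0)"
    by (auto simp: heard_def)
  then show ?thesis using assms by (simp add: ask_def)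
qed

definition poll :: "(nat \<Rightarrow> nat set \<Rightarrow> bool) \<Rightarrow> nat set prog" where
  "poll P = Bcast (\<lambda>x A. of_bool (P x A)) (\<lambda>r. Ret {x. r x = Some 1})"

lemma achieves_poll:
  assumes "1 < B" "achieves X N B (f {x \<in> X. P x (N x)}) T Q"
  shows "achieves X N B (poll P \<bind> f) (Suc T) Q"
proof -
  have "{x. heard X N (\<lambda>x A. of_bool (P x A)) x = Some 1} = {x \<in> X. P x (N x)}"
    by (auto simp: heard_def split: if_splits)
  then show ?thesis using assms by (simp add: poll_def)
qed

definition total :: "(nat \<Rightarrow> nat set \<Rightarrow> int) \<Rightarrow> int prog" where
  "total F = Bcast (\<lambda>x A. int_encode (F x A)) (\<lambda>r. Ret (\<Sum>x\<in>dom r. int_decode (the (r x))))"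

lemma int_encode_le: "int (int_encode z) \<le> 2 * \<bar>z\<bar>"
  by (simp add: int_encode_def sum_encode_def)

lemma achieves_total:
  assumes "\<And>x. x \<in> X \<Longrightarrow> 2 * \<bar>F x (N x)\<bar> < int B"
    and "achieves X N B (f (\<Sum>x\<in>X. F x (N x))) T Q"
  shows "achieves X N B (total F \<bind> f) (Suc T) Q"
proof -
  let ?r = "heard X N (\<lambda>x A. int_encode (F x A))"
  have "dom ?r = X" by (auto simp: heard_def split: if_splits)
  then have "(\<Sum>x\<in>dom ?r. int_decode (the (?r x))) = (\<Sum>x\<in>X. F x (N x))"
    by (intro sum.cong) (auto simp: heard_def)
  moreover have "int_encode (F x (N x)) < B" if "x \<in> X" for x
    using int_encode_le[of "F x (N x)"] assms(1)[OF that] by linarith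
  ultimately show ?thesis using assms(2) by (simp add: total_def)
qed

definition maximum :: "(nat \<Rightarrow> nat set \<Rightarrow> nat) \<Rightarrow> nat prog" where
  "maximum \<mu> = Bcast \<mu> (\<lambda>r. Ret (Max (insert 0 (ran r))))"

lemma achieves_maximum:
  assumes "\<And>x. x \<in> X \<Longrightarrow> \<mu> x (N x) < B"
    and "achieves X N B (f (Max (insert 0 ((\<lambda>x. \<mu> x (N x)) ` X)))) T Q"
  shows "achieves X N B (maximum \<mu> \<bind> f) (Suc T) Q"
proof -
  have "ran (heard X N \<mu>) = (\<lambda>x. \<mu> x (N x)) ` X"
    by (auto simp: heard_def ran_def)
  then show ?thesis using assms by (simp add: maximum_def)
qed

section \<open>Executing programs on views\<close>

primrec next_msg :: "'a prog \<Rightarrow> nat \<Rightarrow> nat set \<Rightarrow> nat" where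
  "next_msg (Ret a) = (\<lambda>_ _. 0)"
| "next_msg (Bcast \<mu> c) = \<mu>"

primrec receive :: "'a prog \<Rightarrow> (nat \<Rightarrow> nat option) \<Rightarrow> 'a prog" where
  "receive (Ret a) r = Ret a"
| "receive (Bcast \<mu> c) r = c r"

primrec result :: "'a prog \<Rightarrow> 'a option" where
  "result (Ret a) = Some a"
| "result (Bcast \<mu> c) = None"

definition msg_of :: "(nat \<Rightarrow> 'a prog) \<Rightarrow> view \<Rightarrow> nat" where
  "msg_of P = (\<lambda>(n, x, A, h). next_msg (foldl receive (P n) h) x A)"

definition out_of :: "(nat \<Rightarrow> nat set prog) \<Rightarrow> view \<Rightarrow> bool option" where
  "out_of P = (\<lambda>(n, x, A, h). map_option (\<lambda>I. x \<in> I) (result (foldl receive (P n) h)))"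

definition step :: "nat set \<Rightarrow> (nat \<Rightarrow> nat set) \<Rightarrow> 'a prog \<Rightarrow> 'a prog" where
  "step X N p = receive p (heard X N (next_msg p))"

lemma funpow_step_Ret: "(step X N ^^ t) (Ret a) = Ret a"
  by (induction t) (simp_all add: step_def)

lemma achieves_funpow_step:
  assumes "achieves X N B p T Q" "0 < B"
  shows "\<exists>a. (step X N ^^ T) p = Ret a \<and> Q a"
    and "t < T \<Longrightarrow> x \<in> X \<Longrightarrow> next_msg ((step X N ^^ t) p) x (N x) < B"
proof -
  have "(\<exists>a. (step X N ^^ T) p = Ret a \<and> Q a) \<and>
    (\<forall>t<T. \<forall>x\<in>X. next_msg ((step X N ^^ t) p) x (N x) < B)"
    using assms(1)
  proof (induction p arbitrary: T)
    case (Ret a)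
    then show ?case using assms(2) by (simp add: funpow_step_Ret)
  next
    case (Bcast \<mu> c)
    then obtain T' where T: "T = Suc T'" by (cases T) auto
    have step: "(step X N ^^ Suc t) (Bcast \<mu> c) = (step X N ^^ t) (c (heard X N \<mu>))" for t
      by (simp add: funpow_Suc_right step_def del: funpow.simps)
    have "next_msg ((step X N ^^ t) (Bcast \<mu> c)) x (N x) < B" if "t < T" "x \<in> X" for t x
      using Bcast that T by (cases t) (auto simp: step simp del: funpow.simps(2))
    then show ?case
      using Bcast.IH[OF rangeI, of "heard X N \<mu>" T'] Bcast.prems T
      by (simp add: step del: funpow.simps)
  qed
  then show "\<exists>a. (step X N ^^ T) p = Ret a \<and> Q a"
    and "t < T \<Longrightarrow> x \<in> X \<Longrightarrow> next_msg ((step X N ^^ t) p) x (N x) < B"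
    by blast+
qed

locale identified_graph =
  fixes n :: nat and E :: "nat \<Rightarrow> nat \<Rightarrow> bool" and idf :: "nat \<Rightarrow> nat"
  assumes simple: "simple_graph n E" and inj_idf: "inj_on idf {..<n}"
begin

definition ids :: "nat set" where
  "ids = idf ` {..<n}"

definition id_nbrs :: "nat \<Rightarrow> nat set" where
  "id_nbrs x = {idf u | u v. idf v = x \<and> E v u}"

lemma edge_less: "E u v \<Longrightarrow> u < n" "E u v \<Longrightarrow> v < n"
  using simple by (auto simp: simple_graph_def)

lemma edge_sym: "E u v \<Longrightarrow> E v u"
  using simple by (auto simp: simple_graph_def)

lemma edge_irrefl: "\<not> E v v"
  using simple by (auto simp: simple_graph_def)

lemma idf_eq_iff: "u < n \<Longrightarrow> v < n \<Longrightarrow> idf u = idf v \<longleftrightarrow> u = v"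
  using inj_idf by (auto simp: inj_on_def)

lemma card_ids: "card ids = n"
  unfolding ids_def using inj_idf by (simp add: card_image)

lemma id_nbrs_idf:
  assumes "v < n"
  shows "id_nbrs (idf v) = idf ` {u. u < n \<and> E v u}"
proof (intro equalityI subsetI)
  fix x assume "x \<in> id_nbrs (idf v)"
  then obtain u v' where "x = idf u" "idf v' = idf v" "E v' u" by (auto simp: id_nbrs_def)
  moreover from this have "v' = v" "u < n" using assms edge_less idf_eq_iff by blast+
  ultimately show "x \<in> idf ` {u. u < n \<and> E v u}" by auto
qed (auto simp: id_nbrs_def)

lemma card_id_nbrs: "v < n \<Longrightarrow> card (id_nbrs (idf v)) = degree n E v"
  using inj_idf by (simp add: id_nbrs_idf degree_def card_image inj_on_def)

sublocale finite_graph ids id_nbrs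
proof
  show "finite ids" by (simp add: ids_def)
  show "id_nbrs x \<subseteq> ids" for x using edge_less by (auto simp: id_nbrs_def ids_def)
  show "x \<in> id_nbrs y" if nbr: "y \<in> id_nbrs x" for x y
  proof -
    obtain u v where "y = idf u" "x = idf v" "E v u" using nbr unfolding id_nbrs_def by blast
    moreover from \<open>E v u\<close> have "E u v" by (rule edge_sym)
    ultimately show ?thesis unfolding id_nbrs_def by blast
  qed
  show "x \<notin> id_nbrs x" for x
  proof
    assume "x \<in> id_nbrs x"
    then obtain u v where "idf v = idf u" "E v u" by (auto simp: id_nbrs_def)
    then show False using edge_less idf_eq_iff edge_irrefl by metis
  qed
qed

lemma max_deg_eq_max_degree: "max_deg ids id_nbrs = max_degree n E"
proof -
  have "deg ` ids = {degree n E v | v. v < n}"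
    by (force simp: ids_def card_id_nbrs image_image)
  then show ?thesis by (simp add: max_deg_def max_degree_def)
qed

lemma views_msg_of:
  "\<exists>h. (\<forall>v<n. views (msg_of P) n E idf t v = (n, idf v, id_nbrs (idf v), h)) \<and>
    foldl receive (P n) h = (step ids id_nbrs ^^ t) (P n)"
proof (induction t)
  case 0
  then show ?case by (auto simp: id_nbrs_idf)
next
  case (Suc t)
  let ?V = "views (msg_of P) n E idf t" and ?p = "(step ids id_nbrs ^^ t) (P n)"
  obtain h where view: "\<And>v. v < n \<Longrightarrow> ?V v = (n, idf v, id_nbrs (idf v), h)"
    and state: "foldl receive (P n) h = ?p"
    using Suc.IH by blast
  have "(\<lambda>x. if x \<in> idf ` {..<n} then Some (msg_of P (?V (the_inv_into {..<n} idf x))) else None)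
      = heard ids id_nbrs (next_msg ?p)"
  proof
    fix x
    show "(if x \<in> idf ` {..<n} then Some (msg_of P (?V (the_inv_into {..<n} idf x))) else None)
        = heard ids id_nbrs (next_msg ?p) x"
    proof (cases "x \<in> ids")
      case True
      then obtain v where "v < n" "x = idf v" by (auto simp: ids_def)
      moreover from this have "msg_of P (?V v) = next_msg ?p x (id_nbrs x)"
        by (simp only: view) (simp add: msg_of_def state)
      ultimately show ?thesis using inj_idf by (simp add: heard_def ids_def the_inv_into_f_f)
    qed (simp add: heard_def ids_def)
  qed
  then have "views (msg_of P) n E idf (Suc t) v
      = (n, idf v, id_nbrs (idf v), h @ [heard ids id_nbrs (next_msg ?p)])" if "v < n" for v
    using view[OF that] by (simp add: Let_def)
  moreover have "foldl receive (P n) (h @ [heard ids id_nbrs (next_msg ?p)])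
      = (step ids id_nbrs ^^ Suc t) (P n)"
    by (simp add: state step_def)
  ultimately show ?case by blast
qed

lemma msg_of_views:
  assumes "v < n"
  shows "msg_of P (views (msg_of P) n E idf t v)
    = next_msg ((step ids id_nbrs ^^ t) (P n)) (idf v) (id_nbrs (idf v))"
  using views_msg_of[of P t] assms by (auto simp: msg_of_def)

lemma out_of_views:
  assumes "v < n"
  shows "out_of P (views (msg_of P) n E idf t v)
    = map_option (\<lambda>I. idf v \<in> I) (result ((step ids id_nbrs ^^ t) (P n)))"
  using views_msg_of[of P t] assms by (auto simp: out_of_def)

lemma maximal_independent_set_if_mis:
  assumes "mis ids id_nbrs I"
  shows "maximal_independent_set n E {v. v < n \<and> idf v \<in> I}"
  unfolding maximal_independent_set_def independent_set_def
proof (intro conjI ballI allI impI)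
  fix u v assume "u \<in> {v. v < n \<and> idf v \<in> I}" "v \<in> {v. v < n \<and> idf v \<in> I}"
  moreover from this have "id_nbrs (idf u) \<inter> I = {}" using assms by (simp add: mis_def)
  ultimately show "\<not> E u v" using id_nbrs_idf[of u] by auto
next
  fix v assume "v < n" "v \<notin> {v. v < n \<and> idf v \<in> I}"
  moreover from this have "id_nbrs (idf v) \<inter> I \<noteq> {}" using assms by (auto simp: mis_def ids_def)
  ultimately show "\<exists>u\<in>{v. v < n \<and> idf v \<in> I}. E v u" using id_nbrs_idf[of v] by auto
qed auto

lemma computes_MIS_within_if_achieves:
  assumes "achieves ids id_nbrs ((n + 2) ^ c) (P n) T (mis ids id_nbrs)"
  shows "computes_MIS_within (msg_of P) (out_of P) c T n E idf"
proof -
  let ?state = "\<lambda>t. (step ids id_nbrs ^^ t) (P n)"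
  obtain I where I: "?state T = Ret I" "mis ids id_nbrs I"
    using achieves_funpow_step(1)[OF assms] by auto
  have "?state t = Ret I" if "T \<le> t" for t
  proof -
    have "?state t = (step ids id_nbrs ^^ (t - T + T)) (P n)" using that by simp
    then have "?state t = (step ids id_nbrs ^^ (t - T)) (?state T)"
      by (simp only: funpow_add comp_apply)
    then show ?thesis by (simp only: I(1) funpow_step_Ret)
  qed
  then have out: "out_of P (views (msg_of P) n E idf t v) = Some (idf v \<in> I)"
    if "T \<le> t" "v < n" for t v
    using that by (simp add: out_of_views)
  have "msg_of P (views (msg_of P) n E idf t v) < (n + 2) ^ c" if "t < T" "v < n" for t v
    unfolding msg_of_views[OF \<open>v < n\<close>]
    using that by (intro achieves_funpow_step(2)[OF assms]) (auto simp: ids_def)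
  moreover have "{v. v < n \<and> out_of P (views (msg_of P) n E idf T v) = Some True}
      = {v. v < n \<and> idf v \<in> I}"
    by (auto simp: out)
  ultimately show ?thesis
    unfolding computes_MIS_within_def
    using maximal_independent_set_if_mis[OF I(2)] by (simp add: out)
qed

end

section \<open>Derandomised phases\<close>

definition half_gap :: "(nat \<Rightarrow> int) \<Rightarrow> nat \<Rightarrow> nat \<Rightarrow> int" where
  "half_gap f b h = (\<Sum>s\<in>{b..<b + h}. f s) - (\<Sum>s\<in>{b + h..<b + 2 * h}. f s)"

lemma sum_half_gap: "(\<Sum>x\<in>X. half_gap (\<lambda>s. F s x) b h) = half_gap (\<lambda>s. \<Sum>x\<in>X. F s x) b h"
  by (simp add: half_gap_def sum_subtractf sum.swap[of _ X])

lemma abs_half_gap_le: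
  assumes "\<And>s. \<bar>f s\<bar> \<le> G"
  shows "\<bar>half_gap f b h\<bar> \<le> 2 * int h * G"
proof -
  have abs_sum_le: "\<bar>\<Sum>s\<in>A. f s\<bar> \<le> int (card A) * G" for A
    using order_trans[OF sum_abs sum_mono[of A "\<lambda>s. \<bar>f s\<bar>" "\<lambda>_. G"]] assms by simp
  then show ?thesis
    using abs_sum_le[of "{b..<b + h}"] abs_sum_le[of "{b + h..<b + 2 * h}"]
    by (simp add: half_gap_def)
qed

lemma sum_le_twice_better_half:
  assumes "c = (if 0 \<le> half_gap f b h then b else b + h)"
  shows "(\<Sum>s\<in>{b..<b + 2 * h}. f s) \<le> 2 * (\<Sum>s\<in>{c..<c + h}. f s)"
proof -
  have "(\<Sum>s\<in>{b..<b + 2 * h}. f s) = (\<Sum>s\<in>{b..<b + h}. f s) + (\<Sum>s\<in>{b + h..<b + 2 * h}. f s)"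
    by (rule sum.atLeastLessThan_concat[symmetric]) auto
  moreover have right_end: "b + h + h = b + 2 * h" by simp
  ultimately show ?thesis
    by (cases "0 \<le> half_gap f b h") (simp_all add: assms half_gap_def right_end)
qed

text \<open>The method of conditional expectations.\<close>

primrec select :: "(nat \<Rightarrow> nat \<Rightarrow> nat set \<Rightarrow> int) \<Rightarrow> nat \<Rightarrow> nat \<Rightarrow> nat prog" where
  "select F 0 b = Ret b"
| "select F (Suc l) b = do {
     D \<leftarrow> total (\<lambda>x A. half_gap (\<lambda>s. F s x A) b (2 ^ l));
     select F l (if 0 \<le> D then b else b + 2 ^ l)
   }"

lemma achieves_select:
  assumes "\<And>s x. x \<in> X \<Longrightarrow> \<bar>F s x (N x)\<bar> \<le> int G" "2 ^ (l + 1) * G < B"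
  shows "achieves X N B (select F l b) l
    (\<lambda>s. (\<Sum>s'\<in>{b..<b + 2 ^ l}. \<Sum>x\<in>X. F s' x (N x)) \<le> 2 ^ l * (\<Sum>x\<in>X. F s x (N x)))"
  using assms(2)
proof (induction l arbitrary: b)
  case 0
  then show ?case by simp
next
  case (Suc l)
  let ?T = "\<lambda>s. \<Sum>x\<in>X. F s x (N x)"
  let ?c = "if 0 \<le> half_gap ?T b (2 ^ l) then b else b + 2 ^ l"
  have "int (2 ^ (Suc l + 1) * G) < int B" using Suc.prems by (simp only: of_nat_less_iff)
  then have message: "2 * \<bar>half_gap (\<lambda>s. F s x (N x)) b (2 ^ l)\<bar> < int B" if "x \<in> X" for x
    using abs_half_gap_le[of "\<lambda>s. F s x (N x)" "int G" b "2 ^ l"] assms(1)[OF that] by simp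
  have "achieves X N B (select F l ?c) l
      (\<lambda>s. (\<Sum>s'\<in>{b..<b + 2 ^ Suc l}. ?T s') \<le> 2 ^ Suc l * ?T s)"
  proof (rule achieves_mono[OF Suc.IH order_refl])
    show "2 ^ (l + 1) * G < B" using Suc.prems by simp
    show "(\<Sum>s'\<in>{b..<b + 2 ^ Suc l}. ?T s') \<le> 2 ^ Suc l * ?T s"
      if "(\<Sum>s'\<in>{?c..<?c + 2 ^ l}. ?T s') \<le> 2 ^ l * ?T s" for s
      using sum_le_twice_better_half[OF refl, of ?T b "2 ^ l"] that unfolding power_Suc by linarith
  qed
  then show ?case
    unfolding select.simps by (intro achieves_total message) (simp_all only: sum_half_gap)
qed

definition elect_winners :: "(nat \<Rightarrow> nat) \<Rightarrow> nat set \<Rightarrow> (nat set \<times> nat set) prog" where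
  "elect_winners d M = do {
     J \<leftarrow> poll (winner d M);
     U \<leftarrow> poll (\<lambda>x A. x \<notin> J \<and> A \<inter> J = {});
     Ret (J, U)
   }"

lemma achieves_elect_winners:
  assumes "1 < B"
    and "\<And>J U. J = {x \<in> X. winner d M x (N x)} \<Longrightarrow> U = {x \<in> X. x \<notin> J \<and> N x \<inter> J = {}} \<Longrightarrow> Q (J, U)"
  shows "achieves X N B (elect_winners d M) 2 Q"
  unfolding elect_winners_def numeral_2_eq_2
  by (intro achieves_poll assms(1), unfold achieves.simps, rule assms(2)[OF refl refl])

definition luby_phase :: "(nat \<Rightarrow> nat \<Rightarrow> nat \<Rightarrow> bool) \<Rightarrow> nat \<Rightarrow> (nat set \<times> nat set) prog" where
  "luby_phase mark L = do {
     d \<leftarrow> ask (\<lambda>x A. card A);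
     t \<leftarrow> ask (cutoff d);
     s \<leftarrow> select (\<lambda>s. gain d (\<lambda>w. {..<t w}) {x. mark s x (level (d x))}) L 0;
     elect_winners d {x. mark s x (level (d x))}
   }"

definition luby_reduction :: "'a set \<Rightarrow> ('a \<Rightarrow> 'a set) \<Rightarrow> 'a set \<Rightarrow> 'a set \<Rightarrow> bool" where
  "luby_reduction X N J U \<longleftrightarrow> J \<subseteq> X \<and> (\<forall>x\<in>J. N x \<inter> J = {}) \<and>
     U = {x \<in> X. x \<notin> J \<and> N x \<inter> J = {}} \<and> 256 * vol U (induced N U) \<le> 255 * vol X N"

locale hashed_graph = finite_graph X N for X :: "nat set" and N :: "nat \<Rightarrow> nat set" +
  fixes mark :: "nat \<Rightarrow> nat \<Rightarrow> nat \<Rightarrow> bool" and b m L :: nat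
  assumes marking: "marking b m L mark"
    and X_less: "X \<subseteq> {..<b}"
    and level_deg_le: "level (deg x) \<le> m"
begin

abbreviation marked :: "nat \<Rightarrow> nat set" where
  "marked s \<equiv> {x. mark s x (level (deg x))}"

abbreviation kept :: "nat \<Rightarrow> nat set" where
  "kept w \<equiv> {..<cutoff deg w (N w)}"

sublocale marked_graph X N kept "{..<2 ^ L}" marked
proof
  fix v
  have "real (card {s \<in> {..<2 ^ L}. v \<in> marked s}) = 2 ^ L / 2 ^ level (deg v)"
    using marking level_deg_le by (simp add: marking_def)
  then show "real (card {..<2 ^ L :: nat}) * mark_prob (deg v)
      \<le> real (card {s \<in> {..<2 ^ L}. v \<in> marked s})"
    by (simp add: mark_prob_def)
next
  fix u v assume "u \<in> X" "v \<in> X" "u \<noteq> v"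
  then have "real (card {s \<in> {..<2 ^ L}. u \<in> marked s \<and> v \<in> marked s})
      \<le> 4 * 2 ^ L / (2 ^ level (deg u) * 2 ^ level (deg v))"
    using marking level_deg_le X_less unfolding marking_def by (auto simp: subset_iff)
  then show "real (card {s \<in> {..<2 ^ L}. u \<in> marked s \<and> v \<in> marked s})
      \<le> 4 * real (card {..<2 ^ L :: nat}) * (mark_prob (deg u) * mark_prob (deg v))"
    by (simp add: mark_prob_def)
next
  fix w
  show "real (card (lowers w)) * mark_prob (deg w) \<le> (\<Sum>v\<in>lowers w \<inter> kept w. mark_prob (deg v))"
    and "(\<Sum>v\<in>lowers w \<inter> kept w. mark_prob (deg v)) \<le> 1 / 16"
    by (intro sum_below_cutoff_ge sum_below_cutoff_le finite_nbrs deg_pos order_refl, assumption)+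
qed simp

lemma hashed_graph_induced:
  assumes "U \<subseteq> X"
  shows "hashed_graph U (induced N U) mark b m L"
proof -
  interpret U: finite_graph U "induced N U" by (rule finite_graph_induced[OF assms])
  show ?thesis
  proof
    show "marking b m L mark" by (rule marking)
    show "U \<subseteq> {..<b}" using assms X_less by simp
    show "level (U.deg x) \<le> m" for x
      using level_mono[OF card_induced_le[of U x]] level_deg_le[of x] by linarith
  qed
qed

lemma abs_gain_kept_le: "\<bar>gain deg kept M x (N x)\<bar> \<le> int (2 * card X ^ 3)"
  using abs_gain_le[of "N x" "card X" deg x kept M] finite_nbrs deg_le_card by simp

lemma luby_reduction_winners:
  assumes "(\<Sum>s'<2 ^ L. \<Sum>x\<in>X. gain deg kept (marked s') x (N x))
      \<le> 2 ^ L * (\<Sum>x\<in>X. gain deg kept (marked s) x (N x))"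
    and J: "J = {x \<in> X. winner deg (marked s) x (N x)}"
    and U: "U = {x \<in> X. x \<notin> J \<and> N x \<inter> J = {}}"
  shows "luby_reduction X N J U"
proof -
  have "\<forall>x\<in>J. N x \<inter> J = {}" using winners_independent[of _ "marked s"] by (auto simp: J)
  moreover have "256 * vol U (induced N U) \<le> 255 * vol X N"
  proof (rule vol_residual_le)
    show "(\<Sum>s'<2 ^ L. \<Sum>x\<in>X. gain deg kept (marked s') x (N x))
        \<le> int (card {..<2 ^ L :: nat}) * (\<Sum>x\<in>X. gain deg kept (marked s) x (N x))"
      using assms(1) by simp
    show "U \<subseteq> {x \<in> X. N x \<inter> winners (marked s) = {}}"
      using nbrs_subset by (auto simp: U J)
  qed (simp add: lessThan_empty_iff)
  moreover have "J \<subseteq> X" by (auto simp: J)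
  ultimately show ?thesis by (simp add: luby_reduction_def U)
qed

lemma achieves_luby_phase:
  assumes "b < B" "card X + 1 < B" "2 ^ (L + 2) * card X ^ 3 < B"
  shows "achieves X N B (luby_phase mark L) (L + 4) (\<lambda>(J, U). luby_reduction X N J U)"
    (is "achieves X N B _ _ ?Q")
proof -
  have degrees: "(if x \<in> X then card (N x) else 0) = deg x" for x
    by (simp add: nbrs_outside)
  have cutoffs: "(if x \<in> X then cutoff deg x (N x) else 0) = cutoff deg x (N x)" for x
    by (simp add: nbrs_outside cutoff_def lower_def)
  have "achieves X N B (elect_winners deg (marked s)) 2 ?Q"
    if "(\<Sum>s'\<in>{0..<0 + 2 ^ L}. \<Sum>x\<in>X. gain deg kept (marked s') x (N x))
      \<le> 2 ^ L * (\<Sum>x\<in>X. gain deg kept (marked s) x (N x))" for s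
    using assms(2) luby_reduction_winners[OF that[unfolded add_0 atLeast0LessThan]]
    by (intro achieves_elect_winners, simp, unfold prod.case)
  then have "achieves X N B
      (select (\<lambda>s. gain deg kept (marked s)) L 0 \<bind> (\<lambda>s. elect_winners deg (marked s))) (L + 2) ?Q"
    by (intro achieves_bind[OF achieves_select[where G = "2 * card X ^ 3"]])
      (use abs_gain_kept_le assms(3) in \<open>simp_all add: mult_ac\<close>)
  then have "achieves X N B (luby_phase mark L) (Suc (Suc (L + 2))) ?Q"
    unfolding luby_phase_def
  proof (intro achieves_ask, unfold degrees cutoffs)
    fix x assume "x \<in> X"
    show "card (N x) < B" using deg_le_card[of x] assms(2) by linarith
    have "cutoff deg x (N x) \<le> b"
      using nbrs_subset X_less by (intro cutoff_le finite_nbrs order_refl deg_pos) auto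
    then show "cutoff deg x (N x) < B" using assms(1) by linarith
  qed
  then show ?thesis by (rule achieves_mono) simp_all
qed

end

section \<open>The complete algorithm\<close>

primrec luby :: "(nat \<Rightarrow> nat \<Rightarrow> nat \<Rightarrow> bool) \<Rightarrow> nat \<Rightarrow> nat \<Rightarrow> nat set prog" where
  "luby mark L 0 = poll (\<lambda>_ _. True)"
| "luby mark L (Suc i) = do {
     (J, U) \<leftarrow> luby_phase mark L;
     I \<leftarrow> restrict_prog U (luby mark L i);
     Ret (J \<union> I)
   }"

lemma luby_reduction_vol_less:
  assumes "luby_reduction X N J U" "255 ^ Suc i * vol X N < 256 ^ Suc i"
  shows "255 ^ i * vol U (induced N U) < 256 ^ i"
proof -
  have "256 * vol U (induced N U) \<le> 255 * vol X N"
    using assms(1) unfolding luby_reduction_def by blast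
  then have "256 * (255 ^ i * vol U (induced N U)) \<le> 255 ^ i * (255 * vol X N)"
    by (subst mult.left_commute) (rule mult_le_mono2)
  also have "\<dots> < 256 ^ Suc i" using assms(2) by (simp only: power_Suc mult_ac)
  finally show ?thesis by simp
qed

lemma achieves_luby:
  assumes "hashed_graph X N mark b m L" "255 ^ i * vol X N < 256 ^ i"
    and "b < B" "card X + 1 < B" "2 ^ (L + 2) * card X ^ 3 < B"
  shows "achieves X N B (luby mark L i) (i * (L + 4) + 1) (mis X N)"
  using assms
proof (induction i arbitrary: X N)
  case 0
  then interpret hashed_graph X N mark b m L by simp
  have "mis X N X" using 0 by (intro mis_if_vol_eq_0) simp
  then show ?case using achieves_poll[of B X N Ret "\<lambda>_ _. True" 0] 0 by (simp add: poll_def)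
next
  case (Suc i)
  then interpret hashed_graph X N mark b m L by simp
  have "achieves X N B (luby mark L (Suc i)) (L + 4 + (i * (L + 4) + 1 + 0)) (mis X N)"
    unfolding luby.simps
  proof (rule achieves_bind[OF achieves_luby_phase[OF Suc.prems(3-5)]])
    fix JU assume "case JU of (J, U) \<Rightarrow> luby_reduction X N J U"
    then obtain J U where JU: "JU = (J, U)" and reduction: "luby_reduction X N J U"
      by (cases JU) auto
    then have J: "J \<subseteq> X" "\<And>x. x \<in> J \<Longrightarrow> N x \<inter> J = {}" and U: "U = {x \<in> X. x \<notin> J \<and> N x \<inter> J = {}}"
      unfolding luby_reduction_def by blast+
    then have "U \<subseteq> X" by blast
    then have card_U: "card U \<le> card X" using finite_X by (intro card_mono)
    let ?N = "induced N U"
    from card_U have "2 ^ (L + 2) * card U ^ 3 \<le> 2 ^ (L + 2) * card X ^ 3"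
      by (intro mult_le_mono2 power_mono) auto
    then have "2 ^ (L + 2) * card U ^ 3 < B" using Suc.prems(5) by (rule le_less_trans)
    then have "achieves U ?N B (luby mark L i) (i * (L + 4) + 1) (mis U ?N)"
      using Suc.prems(3,4) card_U
      by (intro Suc.IH hashed_graph_induced luby_reduction_vol_less[OF reduction] Suc.prems(2)
          \<open>U \<subseteq> X\<close>) auto
    then have "achieves X N B (restrict_prog U (luby mark L i)) (i * (L + 4) + 1) (mis U ?N)"
      using Suc.prems(4) by (intro achieves_restrict_prog \<open>U \<subseteq> X\<close>) auto
    then show "achieves X N B (case JU of (J, U) \<Rightarrow> do {
        I \<leftarrow> restrict_prog U (luby mark L i);
        Ret (J \<union> I)
      }) (i * (L + 4) + 1 + 0) (mis X N)"
      unfolding JU prod.case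
      by (rule achieves_bind) (simp add: mis_extend[OF J U])
  qed
  then show ?case by (simp add: algebra_simps)
qed

primrec collect :: "nat \<Rightarrow> (nat \<Rightarrow> nat set) prog" where
  "collect 0 = Ret (\<lambda>_. {})"
| "collect (Suc i) = do {
     f \<leftarrow> collect i;
     g \<leftarrow> ask (\<lambda>x A. if i < card A then Suc (sorted_list_of_set A ! i) else 0);
     Ret (\<lambda>x. f x \<union> {y. g x = Suc y})
   }"

lemma achieves_collect:
  assumes "finite_graph X N" "X \<subseteq> {..<b}" "b < B"
  shows "achieves X N B (collect i) i (\<lambda>f. f = (\<lambda>x. set (take i (sorted_list_of_set (N x)))))"
proof (induction i)
  case 0
  show ?case by simp
next
  case (Suc i)
  interpret finite_graph X N by (rule assms(1))
  let ?l = "\<lambda>x. sorted_list_of_set (N x)"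
  let ?msg = "\<lambda>x. if i < deg x then Suc (?l x ! i) else 0"
  have message: "?msg x < B" for x
  proof (cases "i < deg x")
    case True
    then have "?l x ! i \<in> N x" using finite_nbrs nth_mem[of i "?l x"] by simp
    then show ?thesis using True assms(2,3) nbrs_subset by fastforce
  qed (use assms(3) in simp)
  have "set (take i (?l x)) \<union> {y. (if x \<in> X then ?msg x else 0) = Suc y}
      = set (take (Suc i) (?l x))" for x
    using nbrs_outside[of x]
    by (cases "i < deg x"; cases "x \<in> X") (auto simp: take_Suc_conv_app_nth)
  then have "achieves X N B (collect (Suc i)) (i + Suc 0)
      (\<lambda>f. f = (\<lambda>x. set (take (Suc i) (?l x))))"
    unfolding collect.simps
    by (intro achieves_bind[OF Suc.IH], hypsubst, intro achieves_ask message) simp_all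
  then show ?case by simp
qed

definition learn_graph_mis :: "nat \<Rightarrow> nat set prog" where
  "learn_graph_mis \<Delta> = do {
     X \<leftarrow> poll (\<lambda>_ _. True);
     N \<leftarrow> collect \<Delta>;
     Ret (SOME I. mis X N I)
   }"

lemma achieves_learn_graph_mis:
  assumes "finite_graph X N" "X \<subseteq> {..<b}" "b < B" "1 < B" "\<And>x. card (N x) \<le> \<Delta>"
  shows "achieves X N B (learn_graph_mis \<Delta>) (\<Delta> + 1) (mis X N)"
proof -
  interpret finite_graph X N by (rule assms(1))
  have "(\<lambda>x. set (take \<Delta> (sorted_list_of_set (N x)))) = N"
    using assms(5) finite_nbrs by simp
  moreover have "mis X N (SOME I. mis X N I)" using mis_exists by (rule someI_ex)
  ultimately have "achieves X N B (do {N \<leftarrow> collect \<Delta>; Ret (SOME I. mis X N I)}) (\<Delta> + 0) (mis X N)"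
    by (intro achieves_bind[OF achieves_collect[OF assms(1-3)]]) simp
  then show ?thesis
    unfolding learn_graph_mis_def Suc_eq_plus1[symmetric]
    using assms(4) by (intro achieves_poll) simp_all
qed

definition seed_length :: "nat \<Rightarrow> nat \<Rightarrow> nat" where
  "seed_length k \<Delta> = 2 * level \<Delta> + ceillog2 ((k + 7) * \<Delta>)"

definition mis_prog :: "nat \<Rightarrow> nat \<Rightarrow> nat set prog" where
  "mis_prog k n = do {
     \<Delta> \<leftarrow> maximum (\<lambda>_ A. card A);
     if 2 ^ \<Delta> \<le> n + 2 then learn_graph_mis \<Delta>
     else luby (SOME mark. marking ((n + 2) ^ k) (level \<Delta>) (seed_length k \<Delta>) mark)
       (seed_length k \<Delta>) (512 * ceillog2 (n + 2))
   }"

definition mis_rounds :: "nat \<Rightarrow> nat \<Rightarrow> nat \<Rightarrow> nat" where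
  "mis_rounds k n \<Delta> = (if 2 ^ \<Delta> \<le> n + 2 then \<Delta> + 2
     else 512 * ceillog2 (n + 2) * (seed_length k \<Delta> + 4) + 2)"

lemma two_power_seed_length_le:
  assumes "0 < \<Delta>"
  shows "2 ^ seed_length k \<Delta> \<le> 2 ^ 13 * (k + 7) * \<Delta> ^ 3"
proof -
  have "2 ^ seed_length k \<Delta> = 2 ^ level \<Delta> * 2 ^ level \<Delta> * (2 ^ ceillog2 ((k + 7) * \<Delta>) :: nat)"
    by (simp add: seed_length_def power_add mult_2)
  also have "\<dots> \<le> (64 * \<Delta>) * (64 * \<Delta>) * (2 * ((k + 7) * \<Delta>))"
    using assms two_power_level_less[OF assms] two_power_ceillog2_gt[of "(k + 7) * \<Delta>"]
    by (intro mult_le_mono) (auto intro: less_imp_le)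
  also have "\<dots> = 2 ^ 13 * (k + 7) * \<Delta> ^ 3" by (simp add: power3_eq_cube algebra_simps)
  finally show ?thesis .
qed

lemma two_power_seed_length_le_power:
  assumes "0 < \<Delta>" "\<Delta> \<le> n"
  shows "2 ^ seed_length k \<Delta> \<le> (n + 2) ^ (k + 23)"
proof -
  have "k + 7 \<le> 2 ^ (k + 7)" using less_exp[of "k + 7"] by simp
  also have "\<dots> \<le> (n + 2) ^ (k + 7)" by (rule power_mono) auto
  finally have "2 ^ 13 * (k + 7) * \<Delta> ^ 3 \<le> (n + 2) ^ 13 * (n + 2) ^ (k + 7) * (n + 2) ^ 3"
    using assms(2) by (intro mult_le_mono power_mono) auto
  also have "\<dots> = (n + 2) ^ (k + 23)" by (simp only: flip: power_add) (simp add: add.commute)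
  finally show ?thesis using two_power_seed_length_le[OF assms(1)] by (rule order_trans[rotated])
qed

lemma marking_seed_length_exists:
  assumes "0 < \<Delta>" "\<Delta> \<le> n" "n + 2 < 2 ^ \<Delta>"
  shows "\<exists>mark. marking ((n + 2) ^ k) (level \<Delta>) (seed_length k \<Delta>) mark"
  unfolding seed_length_def
proof (rule marking_exists)
  have "level \<Delta> + 1 \<le> 2 ^ level \<Delta>" using less_exp[of "level \<Delta>"] by linarith
  also have "\<dots> < 64 * \<Delta>" by (rule two_power_level_less[OF assms(1)])
  also have "\<dots> \<le> (n + 2) ^ 6 * (n + 2)"
    using assms(2) power_mono[of 2 "n + 2" 6] by (intro mult_le_mono) auto
  also have "\<dots> = (n + 2) ^ 7" by (simp only: power_Suc2[symmetric]) simp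
  finally have "(n + 2) ^ k * (level \<Delta> + 1) < (n + 2) ^ k * (n + 2) ^ 7"
    by (intro mult_strict_left_mono) auto
  also have "\<dots> = (n + 2) ^ (k + 7)" by (simp only: power_add)
  also have "\<dots> \<le> (2 ^ \<Delta>) ^ (k + 7)" using assms(3) by (intro power_mono) auto
  also have "\<dots> = 2 ^ ((k + 7) * \<Delta>)" by (simp only: mult.commute flip: power_mult)
  also have "\<dots> \<le> 2 ^ (2 ^ ceillog2 ((k + 7) * \<Delta>))"
    by (intro power_increasing le_two_power_ceillog2) auto
  also have "\<dots> \<le> 4 ^ (2 ^ ceillog2 ((k + 7) * \<Delta>))" by (intro power_mono) auto
  finally show "(n + 2) ^ k * (level \<Delta> + 1) < 4 ^ (2 ^ ceillog2 ((k + 7) * \<Delta>))" .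
qed

lemma pred_power_double_le:
  assumes "0 < c"
  shows "4 * (c - 1) ^ (2 * c) \<le> (c ^ (2 * c) :: nat)"
proof -
  have "(2::real) \<le> exp 1" using exp_ge_add_one_self[of 1] by simp
  then have "exp (- 1 :: real) \<le> 1 / 2" by (simp add: exp_minus field_simps)
  moreover have "(1 - 1 / real c) ^ c \<le> exp (- 1)"
    using exp_ge_one_minus_x_over_n_power_n[of 1 c] assms by simp
  ultimately have "(1 - 1 / real c) ^ c \<le> 1 / 2" by linarith
  then have "((1 - 1 / real c) ^ c)\<^sup>2 \<le> (1 / 2)\<^sup>2"
    using assms by (intro power_mono) auto
  then have "(1 - 1 / real c) ^ (2 * c) \<le> 1 / 4"
    by (simp add: power_even_eq power_divide)
  moreover have "1 - 1 / real c = real (c - 1) / real c"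
    using assms by (simp add: of_nat_diff field_simps)
  ultimately have "4 * real (c - 1) ^ (2 * c) \<le> real c ^ (2 * c)"
    using assms by (simp add: power_divide field_simps)
  then have "real (4 * (c - 1) ^ (2 * c)) \<le> real (c ^ (2 * c))" by simp
  then show ?thesis by (simp only: of_nat_le_iff)
qed

lemma contraction_less:
  fixes v x c j :: nat
  assumes "v \<le> x * x" "x < 2 ^ j" "1 < c"
  shows "(c - 1) ^ (2 * c * j) * v < c ^ (2 * c * j)"
proof -
  have "v < 2 ^ j * 2 ^ j" using assms mult_strict_mono[of x "2 ^ j" x "2 ^ j"] by simp
  then have "v < 4 ^ j" by (simp flip: power_mult_distrib)
  then have "(c - 1) ^ (2 * c * j) * v < (c - 1) ^ (2 * c * j) * 4 ^ j" using assms(3) by simp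
  also have "\<dots> = (4 * (c - 1) ^ (2 * c)) ^ j"
    by (simp only: power_mult[of _ "2 * c" j] power_mult_distrib[symmetric] mult.commute[of _ 4])
  also have "\<dots> \<le> (c ^ (2 * c)) ^ j" using assms(3) by (intro power_mono pred_power_double_le) auto
  also have "\<dots> = c ^ (2 * c * j)" by (simp only: power_mult)
  finally show ?thesis .
qed

lemma achieves_luby_seed_length:
  assumes "finite_graph X N" "card X = n" "X \<subseteq> {..<(n + 2) ^ k}"
    and "marking ((n + 2) ^ k) (level \<Delta>) (seed_length k \<Delta>) mark"
    and "\<And>x. card (N x) \<le> \<Delta>" "0 < \<Delta>" "\<Delta> \<le> n"
  shows "achieves X N ((n + 2) ^ (k + 30)) (luby mark (seed_length k \<Delta>) (512 * ceillog2 (n + 2)))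
    (512 * ceillog2 (n + 2) * (seed_length k \<Delta> + 4) + 1) (mis X N)"
proof (rule achieves_luby)
  interpret finite_graph X N by (rule assms(1))
  show "hashed_graph X N mark ((n + 2) ^ k) (level \<Delta>) (seed_length k \<Delta>)"
    by unfold_locales (use assms in \<open>auto intro: level_mono\<close>)
  have "n < 2 ^ ceillog2 (n + 2)" using le_two_power_ceillog2[of "n + 2"] by linarith
  then have "(256 - 1) ^ (2 * 256 * ceillog2 (n + 2)) * vol X N
      < 256 ^ (2 * 256 * ceillog2 (n + 2))"
    using vol_le assms(2) by (intro contraction_less[of _ n]) auto
  moreover have "256 - 1 = (255 :: nat)" "2 * 256 = (512 :: nat)" by simp_all
  ultimately show "255 ^ (512 * ceillog2 (n + 2)) * vol X N < 256 ^ (512 * ceillog2 (n + 2))"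
    by (simp only:)
  show "(n + 2) ^ k < (n + 2) ^ (k + 30)" by (intro power_strict_increasing) auto
  show "card X + 1 < (n + 2) ^ (k + 30)"
    using assms(2) self_le_power[of "n + 2" "k + 30"] by simp
  have "2 ^ (seed_length k \<Delta> + 2) * n ^ 3 = 2 ^ seed_length k \<Delta> * 2 ^ 2 * n ^ 3"
    by (simp only: power_add)
  also have "\<dots> \<le> (n + 2) ^ (k + 23) * (n + 2) ^ 2 * (n + 2) ^ 3"
    using two_power_seed_length_le_power[OF assms(6,7)] by (intro mult_le_mono power_mono) auto
  also have "\<dots> = (n + 2) ^ (k + 28)" by (simp only: flip: power_add) (simp add: add.commute)
  also have "\<dots> < (n + 2) ^ (k + 30)" by (intro power_strict_increasing) auto
  finally show "2 ^ (seed_length k \<Delta> + 2) * card X ^ 3 < (n + 2) ^ (k + 30)"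
    by (simp only: assms(2))
qed

lemma achieves_mis_prog:
  assumes "finite_graph X N" "card X = n" "X \<subseteq> {..<(n + 2) ^ k}"
  shows "achieves X N ((n + 2) ^ (k + 30)) (mis_prog k n) (mis_rounds k n (max_deg X N)) (mis X N)"
proof -
  interpret finite_graph X N by (rule assms(1))
  define B where "B = (n + 2) ^ (k + 30)"
  define \<Delta> where "\<Delta> = max_deg X N"
  have B: "(n + 2) ^ k < B" "n + 2 \<le> B"
    unfolding B_def by (intro power_strict_increasing self_le_power; simp)+
  have deg_le: "deg x \<le> \<Delta>" for x unfolding \<Delta>_def by (rule deg_le_max_deg)
  have "\<Delta> \<le> n" using max_deg_le_card assms(2) by (simp add: \<Delta>_def)
  have message: "deg x < B" for x using deg_le[of x] \<open>\<Delta> \<le> n\<close> B(2) by linarith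
  have "achieves X N B (mis_prog k n) (mis_rounds k n \<Delta>) (mis X N)"
  proof (cases "2 ^ \<Delta> \<le> n + 2")
    case True
    have "achieves X N B (learn_graph_mis \<Delta>) (\<Delta> + 1) (mis X N)"
      by (rule achieves_learn_graph_mis[OF assms(1,3) B(1) _ deg_le]) (use B(2) in simp)
    then have "achieves X N B (mis_prog k n) (Suc (\<Delta> + 1)) (mis X N)"
      unfolding mis_prog_def
      by (intro achieves_maximum message, fold max_deg_def \<Delta>_def) (simp only: True if_True)
    then show ?thesis using True by (simp add: mis_rounds_def)
  next
    case False
    then have "n + 2 < 2 ^ \<Delta>" by (rule not_le_imp_less)
    then have "0 < \<Delta>" by (cases \<Delta>) auto
    note marking = someI_ex[OF marking_seed_length_exists[OF \<open>0 < \<Delta>\<close> \<open>\<Delta> \<le> n\<close> \<open>n + 2 < 2 ^ \<Delta>\<close>]]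
    note achieves_luby_seed_length[OF assms marking deg_le \<open>0 < \<Delta>\<close> \<open>\<Delta> \<le> n\<close>, folded B_def]
    then have "achieves X N B (mis_prog k n)
        (Suc (512 * ceillog2 (n + 2) * (seed_length k \<Delta> + 4) + 1)) (mis X N)"
      unfolding mis_prog_def
      by (intro achieves_maximum message, fold max_deg_def \<Delta>_def) (simp only: False if_False)
    then show ?thesis using False by (simp add: mis_rounds_def)
  qed
  then show ?thesis by (simp only: B_def \<Delta>_def)
qed

lemma seed_length_le:
  "real (seed_length k \<Delta>) + 4 \<le> (real k + 27) * log 2 (real \<Delta> + 2)"
proof (cases "\<Delta> = 0")
  case True
  then show ?thesis by (simp add: seed_length_def level_def)
next
  case False
  define a where "a = log 2 (real \<Delta> + 2)"
  have a: "1 \<le> a" "log 2 (real \<Delta>) \<le> a" using False by (auto simp: a_def le_log_iff)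
  have "real (level \<Delta>) \<le> 6 + a"
    using ceillog2_less_log[of "32 * \<Delta>"] a False log_nat_power[of 2 2 5]
    by (simp add: level_def log_mult)
  moreover have "real (ceillog2 ((k + 7) * \<Delta>)) \<le> real k + 8 + a"
  proof -
    have "real (k + 7) \<le> real (2 ^ (k + 7))" using less_exp[of "k + 7"] by (intro of_nat_mono) simp
    then have "log 2 (real (k + 7)) \<le> real (k + 7)" by (intro log2_of_power_le) simp_all
    then show ?thesis
      using ceillog2_less_log[of "(k + 7) * \<Delta>"] a False by (simp add: log_mult)
  qed
  ultimately have "real (seed_length k \<Delta>) + 4 \<le> (real k + 24) * 1 + 3 * a"
    by (simp add: seed_length_def)
  also have "\<dots> \<le> (real k + 24) * a + 3 * a" using a by (intro add_right_mono mult_left_mono) auto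
  finally show ?thesis by (simp add: a_def algebra_simps)
qed

lemma mis_rounds_le:
  "real (mis_rounds k n \<Delta>)
    \<le> (1024 * (real k + 27) + 2) * log 2 (real \<Delta> + 2) * log 2 (real n + 2)"
proof -
  define a where "a = log 2 (real \<Delta> + 2)"
  define b where "b = log 2 (real n + 2)"
  have a: "1 \<le> a" and b: "1 \<le> b" by (auto simp: a_def b_def le_log_iff)
  have ab: "b \<le> a * b" "1 \<le> a * b" using mult_mono[of 1 a 1 b] mult_right_mono[of 1 a b] a b by auto
  have "real (mis_rounds k n \<Delta>) \<le> (1024 * (real k + 27) + 2) * (a * b)"
  proof (cases "2 ^ \<Delta> \<le> n + 2")
    case True
    then have "2 ^ \<Delta> \<le> real n + 2" using of_nat_mono[of "2 ^ \<Delta>" "n + 2", where ?'a = real] by simp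
    then have "real \<Delta> \<le> b" unfolding b_def by (subst le_log_iff) (auto simp: powr_realpow)
    then have "real (mis_rounds k n \<Delta>) \<le> 3 * (a * b)" using True ab by (simp add: mis_rounds_def)
    also have "\<dots> \<le> (1024 * (real k + 27) + 2) * (a * b)" using ab by (intro mult_right_mono) auto
    finally show ?thesis .
  next
    case False
    have "real (ceillog2 (n + 2)) < b + 1"
      using ceillog2_less_log[of "n + 2"] by (simp add: b_def add.commute)
    then have "real (ceillog2 (n + 2)) \<le> 2 * b" using b by linarith
    moreover have "real (seed_length k \<Delta>) + 4 \<le> (real k + 27) * a"
      unfolding a_def by (rule seed_length_le)
    ultimately have product: "real (ceillog2 (n + 2)) * (real (seed_length k \<Delta>) + 4)
        \<le> (2 * b) * ((real k + 27) * a)"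
      using b by (intro mult_mono) auto
    have "real (mis_rounds k n \<Delta>)
        = 512 * (real (ceillog2 (n + 2)) * (real (seed_length k \<Delta>) + 4)) + 2"
      using False by (simp add: mis_rounds_def)
    also have "\<dots> \<le> 512 * ((2 * b) * ((real k + 27) * a)) + 2"
      by (intro add_right_mono mult_left_mono product) simp
    also have "\<dots> = 1024 * (real k + 27) * (a * b) + 2 * 1" by simp
    also have "\<dots> \<le> 1024 * (real k + 27) * (a * b) + 2 * (a * b)"
      by (intro add_left_mono mult_left_mono ab) simp
    finally show ?thesis by (simp only: distrib_right)
  qed
  then show ?thesis unfolding a_def b_def by (simp only: mult.assoc)
qed

theorem theorem2:
  shows "\<forall>k::nat. \<exists>(msg :: view \<Rightarrow> nat) (out :: view \<Rightarrow> bool option) (c::nat) (C::real).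
     \<forall>n E (idf :: nat \<Rightarrow> nat).
       simple_graph n E \<longrightarrow> inj_on idf {..<n} \<longrightarrow> (\<forall>v<n. idf v < (n + 2) ^ k) \<longrightarrow>
       (\<exists>T::nat. real T \<le> C * log 2 (real (max_degree n E) + 2) * log 2 (real n + 2) \<and>
                 computes_MIS_within msg out c T n E idf)"
proof (rule allI, intro exI allI impI)
  fix k n E and idf :: "nat \<Rightarrow> nat"
  assume "simple_graph n E" "inj_on idf {..<n}" and small: "\<forall>v<n. idf v < (n + 2) ^ k"
  then interpret identified_graph n E idf by unfold_locales
  let ?T = "mis_rounds k n (max_degree n E)"
  have "ids \<subseteq> {..<(n + 2) ^ k}" using small by (auto simp: ids_def)
  then have "achieves ids id_nbrs ((n + 2) ^ (k + 30)) (mis_prog k n) ?T (mis ids id_nbrs)"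
    unfolding max_deg_eq_max_degree[symmetric]
    by (intro achieves_mis_prog finite_graph_axioms card_ids)
  then have "computes_MIS_within (msg_of (mis_prog k)) (out_of (mis_prog k)) (k + 30) ?T n E idf"
    by (rule computes_MIS_within_if_achieves)
  then show "real ?T \<le> (1024 * (real k + 27) + 2)
        * log 2 (real (max_degree n E) + 2) * log 2 (real n + 2) \<and>
      computes_MIS_within (msg_of (mis_prog k)) (out_of (mis_prog k)) (k + 30) ?T n E idf"
    by (intro conjI mis_rounds_le)
qed

end
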